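(* Let $\Phi^0$ be a homogeneous Poisson point process on $\mathbb{R}$ ($d=1$). Under the Palm probability of $\Phi^0$, the $\mathrm{CHN}^2$ Eternal Family Forest $G$ is almost surely connected.
   Context: Standing assumptions: $\Phi^0$ is a simple point process with a.s. pairwise distinct interpoint distances. For finite sets $S,T$ let $\delta(S,T)=\min_{x\in S,y\in T}|x-y|$. Graph of a point-shift $h$: vertices the points, directed edges $x\to h(x)$. $\mathrm{CHN}^2$ construction. $f^0(x)$ is the nearest neighbour of $x$. Inductively, suppose $f^{k-1}$ is defined and every connected component of its graph is finite and contains exactly one cycle, which has length $2$ (a pair $\{a,b\}$ with $f^{k-1}(a)=b$ and $f^{k-1}(b)=a$). These pairs are denoted $S^{k-1}_i$. For each pair $S^{k-1}_i$, let $S^{k-1}_j$ ($j\ne i$) minimize $\delta(S^{k-1}_i,S^{k-1}_j)$, and let $x_i\in S^{k-1}_i$, $x_j\in S^{k-1}_j$ attain the minimum; $x_i$ is the exit point of order $k-1$. Set $f^k(x_i)=x_j$ for exit points and $f^k(y)=f^{k-1}(y)$ otherwise. For the Poisson process this is a.s. well defined at all levels. For every $x$ the sequence $f^n(x)$ is a.s. eventually constant, with eventual value $f^\infty(x)$. The graph $G$ of $f^\infty$ (on the Palm version $\Phi^0\cup\{0\}$), viewed as an undirected graph, is the $\mathrm{CHN}^2$ Eternal Family Forest. *)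

theory Defs
  imports "HOL-Probability.Probability"
begin

section \<open>Homogeneous Poisson point process on the real line\<close>

text \<open>A random point configuration Phi (a random subset of the reals) on the probability
space M is a homogeneous Poisson point process of intensity lam if: counts in bounded Borel
sets are finite, measurable and Poisson distributed with mean lam times the Lebesgue measure
of the set, and counts in (finitely many) pairwise disjoint bounded Borel sets are independent.\<close>

definition poisson_pp :: "'w measure \<Rightarrow> real \<Rightarrow> ('w \<Rightarrow> real set) \<Rightarrow> bool" where
  "poisson_pp M lam Phi \<longleftrightarrow>
     0 < lam \<and>
     (\<forall>B. B \<in> sets borel \<and> bounded B \<longrightarrow>
        (\<forall>\<omega>\<in>space M. finite (Phi \<omega> \<inter> B)) \<and>
        (\<lambda>\<omega>. card (Phi \<omega> \<inter> B)) \<in> measurable M (count_space UNIV) \<and>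
        (\<forall>k::nat. measure M {\<omega> \<in> space M. card (Phi \<omega> \<inter> B) = k} =
            (lam * measure lborel B) ^ k / fact k * exp (- (lam * measure lborel B)))) \<and>
     (\<forall>(I::nat set) (B::nat \<Rightarrow> real set). finite I \<and> disjoint_family_on B I \<and>
        (\<forall>i\<in>I. B i \<in> sets borel \<and> bounded (B i)) \<longrightarrow>
        prob_space.indep_vars M (\<lambda>_. count_space UNIV) (\<lambda>i \<omega>. card (Phi \<omega> \<inter> B i)) I)"

section \<open>The CHN^2 construction on a point configuration S\<close>

text \<open>Level 0: nearest neighbour.\<close>
definition nn :: "real set \<Rightarrow> real \<Rightarrow> real" where
  "nn S x = (THE y. y \<in> S \<and> y \<noteq> x \<and> (\<forall>z\<in>S - {x}. \<bar>x - y\<bar> \<le> \<bar>x - z\<bar>))"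

text \<open>The 2-cycles {a,b} (f a = b, f b = a, a \<noteq> b) of a point-shift f on S.\<close>
definition cycles2 :: "real set \<Rightarrow> (real \<Rightarrow> real) \<Rightarrow> real set set" where
  "cycles2 S f = {{a, b} | a b. a \<in> S \<and> b \<in> S \<and> a \<noteq> b \<and> f a = b \<and> f b = a}"

text \<open>delta(P,Q): minimal distance between two finite sets.\<close>
definition delta :: "real set \<Rightarrow> real set \<Rightarrow> real" where
  "delta P Q = Min {\<bar>x - y\<bar> | x y. x \<in> P \<and> y \<in> Q}"

text \<open>y is the exit point of the 2-cycle P (for the point-shift f) and z is the point of the
closest other 2-cycle Q attaining delta(P,Q), the minimum over all other 2-cycles.\<close>
definition exit_pt :: "real set \<Rightarrow> (real \<Rightarrow> real) \<Rightarrow> real set \<Rightarrow> real \<Rightarrow> real \<Rightarrow> bool" where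
  "exit_pt S f P y z \<longleftrightarrow> P \<in> cycles2 S f \<and> y \<in> P \<and>
     (\<exists>Q\<in>cycles2 S f. Q \<noteq> P \<and> z \<in> Q \<and> \<bar>y - z\<bar> = delta P Q \<and>
        (\<forall>Q'\<in>cycles2 S f. Q' \<noteq> P \<longrightarrow> delta P Q \<le> delta P Q'))"

text \<open>One step of the construction: f^k from f^(k-1).\<close>
definition chn_step :: "real set \<Rightarrow> (real \<Rightarrow> real) \<Rightarrow> real \<Rightarrow> real" where
  "chn_step S f y = (if \<exists>P z. exit_pt S f P y z then (THE z. \<exists>P. exit_pt S f P y z) else f y)"

text \<open>chn S k = f^k on S.\<close>
primrec chn :: "real set \<Rightarrow> nat \<Rightarrow> real \<Rightarrow> real" where
  "chn S 0 = nn S"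
| "chn S (Suc k) = chn_step S (chn S k)"

text \<open>f^infinity: the eventual value of the sequence f^n(x).\<close>
definition chn_inf :: "real set \<Rightarrow> real \<Rightarrow> real" where
  "chn_inf S x = (THE v. \<exists>N. \<forall>n\<ge>N. chn S n x = v)"

text \<open>Directed edges x -> f^infinity(x) of the Eternal Family Forest on S.\<close>
definition eff_edges :: "real set \<Rightarrow> (real \<times> real) set" where
  "eff_edges S = {(x, chn_inf S x) | x. x \<in> S}"

text \<open>Connectedness of the undirected graph on vertex set S with these edges.\<close>
definition eff_connected :: "real set \<Rightarrow> bool" where
  "eff_connected S \<longleftrightarrow>
     (\<forall>x\<in>S. \<forall>y\<in>S. (x, y) \<in> (eff_edges S \<union> (eff_edges S)\<inverse>)\<^sup>*)"

end

theory Submission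
  imports Defs
begin

text \<open>
  At every level the 2-cycles of the construction are disjoint intervals of the line, and the next
  2-cycles are the gaps between neighbouring intervals that are mutually closest. A redirected edge
  stays present with the opposite orientation, because only one endpoint of a 2-cycle is an exit
  point, so the components of the graph only grow. They are convex, and none of them is finite: in
  a finite component the set of endpoints of 2-cycles would shrink strictly at every level. Hence at
  most one gap of the configuration separates two components. A stationary process almost surely
  does not single out a point in a translation covariant way, so for the Poisson process there is
  no such gap, and for the same reason no level has a last interval. Ties between distances are
  excluded, and the result is transferred to the process with an added point at 0, by comparing the
  process having exactly one point in a small interval with the process having none there and a
  uniform point added.
\<close>

section \<open>The nested intervals of a configuration\<close>

text \<open>For k > 0 the intervals of \<open>level S k\<close> are the 2-cycles of \<open>chn S (k - 1)\<close>. Starting from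
  the degenerate intervals [x, x] makes the nearest neighbour step an instance of the exit step.\<close>

definition exit_right :: "real set \<Rightarrow> (real \<Rightarrow> real \<Rightarrow> bool) \<Rightarrow> real \<Rightarrow> real \<Rightarrow> bool" where
  "exit_right S Q b c \<longleftrightarrow> b < c \<and> (\<exists>a\<in>S. \<exists>d\<in>S. Q a b \<and> Q c d \<and>
     (\<forall>e\<in>S. \<forall>f\<in>S. Q e f \<longrightarrow> (e = a \<and> f = b) \<or> c - b \<le> a - f \<or> c - b \<le> e - b))"

definition exit_left :: "real set \<Rightarrow> (real \<Rightarrow> real \<Rightarrow> bool) \<Rightarrow> real \<Rightarrow> real \<Rightarrow> bool" where
  "exit_left S Q b c \<longleftrightarrow> b < c \<and> (\<exists>a\<in>S. \<exists>d\<in>S. Q a b \<and> Q c d \<and>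
     (\<forall>e\<in>S. \<forall>f\<in>S. Q e f \<longrightarrow> (e = c \<and> f = d) \<or> c - b \<le> e - d \<or> c - b \<le> c - f))"

primrec level :: "real set \<Rightarrow> nat \<Rightarrow> real \<Rightarrow> real \<Rightarrow> bool" where
  "level S 0 = (\<lambda>a b. a \<in> S \<and> b = a)"
| "level S (Suc k) = (\<lambda>b c. exit_right S (level S k) b c \<and> exit_left S (level S k) b c)"

text \<open>The point x is the exit point of its interval at level k and is redirected to y.\<close>

definition link :: "real set \<Rightarrow> nat \<Rightarrow> real \<Rightarrow> real \<Rightarrow> bool" where
  "link S k x y \<longleftrightarrow> exit_right S (level S k) x y \<or> exit_left S (level S k) y x"

definition tie :: "real set \<Rightarrow> real \<Rightarrow> bool" where
  "tie S w \<longleftrightarrow> (\<exists>x\<in>S. \<exists>y\<in>S. \<exists>z\<in>S. x \<noteq> w \<and> y \<noteq> w \<and> z \<noteq> w \<and> w = x + y - z)"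

definition last_end :: "real set \<Rightarrow> nat \<Rightarrow> real \<Rightarrow> bool" where
  "last_end S k x \<longleftrightarrow> (\<exists>a\<in>S. level S k a x) \<and> (\<forall>e\<in>S. \<forall>f\<in>S. level S k e f \<longrightarrow> f \<le> x)"

definition locally_finite :: "real set \<Rightarrow> bool" where
  "locally_finite S \<longleftrightarrow> (\<forall>B. bounded B \<longrightarrow> finite (S \<inter> B))"

definition linked :: "real set \<Rightarrow> nat \<Rightarrow> (real \<times> real) set" where
  "linked S k = {(x, y). \<exists>j<k. link S j x y \<or> link S j y x}\<^sup>*"

definition persistent_gap :: "real set \<Rightarrow> real \<Rightarrow> bool" where
  "persistent_gap S x \<longleftrightarrow> (\<exists>y\<in>S. x < y \<and> (\<forall>z\<in>S. \<not> (x < z \<and> z < y)) \<and> (\<forall>k. (x, y) \<notin> linked S k))"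

lemma level_in: "level S k a b \<Longrightarrow> a \<in> S \<and> b \<in> S"
proof (induction k arbitrary: a b)
  case (Suc k)
  then have "exit_right S (level S k) a b" by simp
  then show ?case unfolding exit_right_def using Suc.IH by blast
qed simp

lemma level_le: "level S k a b \<Longrightarrow> a \<le> b"
  by (cases k) (auto simp: exit_right_def)

lemma level_less: "level S (Suc k) a b \<Longrightarrow> a < b"
  by (auto simp: exit_right_def)

lemma link_in: "link S k x y \<Longrightarrow> x \<in> S \<and> y \<in> S"
  unfolding link_def exit_right_def exit_left_def using level_in by blast

section \<open>Components of generic configurations\<close>

locale generic_config =
  fixes S :: "real set"
  assumes locally_finite: "locally_finite S"
    and no_tie: "\<And>w. w \<in> S \<Longrightarrow> \<not> tie S w"
    and no_last: "\<And>k x. x \<in> S \<Longrightarrow> \<not> last_end S k x"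
begin

lemma finite_Int_bounded: "bounded B \<Longrightarrow> finite (S \<inter> B)"
  using locally_finite by (simp add: locally_finite_def)

lemma no_tie_eq: "w \<in> S \<Longrightarrow> x \<in> S \<Longrightarrow> y \<in> S \<Longrightarrow> z \<in> S \<Longrightarrow> x \<noteq> w \<Longrightarrow> y \<noteq> w \<Longrightarrow> z \<noteq> w \<Longrightarrow> w \<noteq> x + y - z"
  using no_tie unfolding tie_def by blast

abbreviation "disjoint_level k \<equiv> (\<forall>a b c d. level S k a b \<longrightarrow> level S k c d \<longrightarrow> (a = c \<and> b = d) \<or>
    b < c \<or> d < a)"

lemma exit_rightD:
  assumes "exit_right S (level S k) b c" "disjoint_level k" "level S k a b"
  shows "b < c \<and> (\<exists>d. level S k c d) \<and>
    (\<forall>e f. level S k e f \<longrightarrow> (e = a \<and> f = b) \<or> c - b \<le> a - f \<or> c - b \<le> e - b)"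
proof -
  from assms(1) obtain a' d where *: "b < c" "level S k a' b" "level S k c d"
     "\<And>e f. e \<in> S \<Longrightarrow> f \<in> S \<Longrightarrow> level S k e f \<Longrightarrow> (e = a' \<and> f = b) \<or> c - b \<le> a' - f \<or> c - b \<le> e - b"
    unfolding exit_right_def by blast
  have "a' = a" using *(2) assms(2,3) level_le[of S k a b] level_le[of S k a' b] by fastforce
  then show ?thesis using * level_in by blast
qed

lemma exit_leftD:
  assumes "exit_left S (level S k) b c" "disjoint_level k" "level S k c d"
  shows "b < c \<and> (\<exists>a. level S k a b) \<and>
    (\<forall>e f. level S k e f \<longrightarrow> (e = c \<and> f = d) \<or> c - b \<le> e - d \<or> c - b \<le> c - f)"
proof -
  from assms(1) obtain a d' where *: "b < c" "level S k a b" "level S k c d'"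
     "\<And>e f. e \<in> S \<Longrightarrow> f \<in> S \<Longrightarrow> level S k e f \<Longrightarrow> (e = c \<and> f = d') \<or> c - b \<le> e - d' \<or> c - b \<le> c - f"
    unfolding exit_left_def by blast
  have "d' = d" using *(3) assms(2,3) level_le[of S k c d] level_le[of S k c d'] by fastforce
  then show ?thesis using * level_in by blast
qed

lemma exit_both_aux:
  assumes d: "disjoint_level k" and "level S k a b" "exit_right S (level S k) b c"
      "exit_left S (level S k) e a"
  shows False
proof -
  obtain d where R: "b < c" "level S k c d"
      "\<And>e f. level S k e f \<Longrightarrow> (e = a \<and> f = b) \<or> c - b \<le> a - f \<or> c - b \<le> e - b"
    using exit_rightD[OF assms(3) d assms(2)] by blast
  obtain g where L: "e < a" "level S k g e"
      "\<And>e' f. level S k e' f \<Longrightarrow> (e' = a \<and> f = b) \<or> a - e \<le> e' - b \<or> a - e \<le> a - f"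
    using exit_leftD[OF assms(4) d assms(2)] by blast
  have ab: "a \<le> b" "g \<le> e" "c \<le> d" using assms(2) L(2) R(2) level_le by auto
  have "c - b \<le> a - e" using R(3)[OF L(2)] L(1) R(1) ab by auto
  moreover have "a - e \<le> c - b" using L(3)[OF R(2)] L(1) R(1) ab by auto
  ultimately have "c = a + b - e" by simp
  then show False using no_tie_eq[of c a b e] level_in[OF R(2)] level_in[OF L(2)] level_in[OF assms(2)] R(1) L(1) ab
    by auto
qed

lemma disjoint: "disjoint_level k"
proof (induction k)
  case 0
  then show ?case by auto
next
  case (Suc k)
  note d = Suc.IH
  have main: "b1 = b2 \<and> c1 = c2 \<or> c1 < b2"
    if 1: "level S (Suc k) b1 c1" and 2: "level S (Suc k) b2 c2" and le: "b1 \<le> b2" for b1 c1 b2 c2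
  proof -
    from 1 have r1: "exit_right S (level S k) b1 c1" and l1: "exit_left S (level S k) b1 c1" by auto
    from 2 have r2: "exit_right S (level S k) b2 c2" and l2: "exit_left S (level S k) b2 c2" by auto
    obtain a1 d1 where a1: "level S k a1 b1" "level S k c1 d1" using r1 unfolding exit_right_def by blast
    obtain a2 d2 where a2: "level S k a2 b2" "level S k c2 d2" using r2 unfolding exit_right_def by blast
    note R1 = exit_rightD[OF r1 d a1(1)]
    note R2 = exit_rightD[OF r2 d a2(1)]
    have le': "a1 \<le> b1" "c1 \<le> d1" "a2 \<le> b2" "c2 \<le> d2" using a1 a2 level_le by auto
    consider "a1 = a2 \<and> b1 = b2" | "b1 < a2" using d a1(1) a2(1) le le' by (metis not_le order_trans)
    then show ?thesis
    proof cases
      case 1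
      have "c1 - b1 \<le> c2 - b1" using R1 a2(2) 1 R2 le' by (smt (verit))
      moreover have "c2 - b1 \<le> c1 - b1" using R2 a1(2) 1 R1 le' by (smt (verit))
      ultimately show ?thesis using 1 by simp
    next
      case 2
      have "c1 \<noteq> a2"
      proof
        assume eq: "c1 = a2"
        then have "level S k a2 d1" using a1 by simp
        then have "d1 = b2" using d a2(1) le' eq by (smt (verit))
        then show False using exit_both_aux[OF d a2(1) r2, of b1] l1 eq by simp
      qed
      moreover have "\<not> b2 < c1" using R1 a2(1) 2 le' by (smt (verit))
      ultimately have "c1 < b2" using d a1(2) a2(1) le' by (smt (verit))
      then show ?thesis by simp
    qed
  qed
  show ?case
  proof (intro allI impI)
    fix a b c e assume "level S (Suc k) a b" "level S (Suc k) c e"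
    then show "a = c \<and> b = e \<or> b < c \<or> e < a"
      using main[of a b c e] main[of c e a b] by linarith
  qed
qed

lemmas exit_right_rule = exit_rightD[OF _ disjoint]
lemmas exit_left_rule = exit_leftD[OF _ disjoint]
lemmas exit_both = exit_both_aux[OF disjoint]

lemma level_cases: "level S k a b \<Longrightarrow> level S k c d \<Longrightarrow> (a = c \<and> b = d) \<or> b < c \<or> d < a"
  using disjoint by blast

lemma exit_rightI:
  assumes "level S k a b" "level S k c d" "b < c"
    "\<And>e f. level S k e f \<Longrightarrow> (e = a \<and> f = b) \<or> c - b \<le> a - f \<or> c - b \<le> e - b"
  shows "exit_right S (level S k) b c"
  unfolding exit_right_def using assms level_in by blast

lemma exit_leftI:
  assumes "level S k a b" "level S k c d" "b < c"
    "\<And>e f. level S k e f \<Longrightarrow> (e = c \<and> f = d) \<or> c - b \<le> e - d \<or> c - b \<le> c - f"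
  shows "exit_left S (level S k) b c"
  unfolding exit_left_def using assms level_in by blast

lemma exit_rightE:
  assumes "exit_right S (level S k) b c"
  obtains a d where "level S k a b" "level S k c d" "b < c"
    "\<And>e f. level S k e f \<Longrightarrow> (e = a \<and> f = b) \<or> c - b \<le> a - f \<or> c - b \<le> e - b"
proof -
  obtain a where "level S k a b" using assms unfolding exit_right_def by blast
  with exit_right_rule[OF assms this] that show thesis by blast
qed

lemma exit_leftE:
  assumes "exit_left S (level S k) b c"
  obtains a d where "level S k a b" "level S k c d" "b < c"
    "\<And>e f. level S k e f \<Longrightarrow> (e = c \<and> f = d) \<or> c - b \<le> e - d \<or> c - b \<le> c - f"
proof -
  obtain d where "level S k c d" using assms unfolding exit_left_def by blast
  with exit_left_rule[OF assms this] that show thesis by blast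
qed

lemma level_right: "level S k a b \<Longrightarrow> \<exists>c d. level S k c d \<and> b < c"
proof -
  assume ab: "level S k a b"
  then have "b \<in> S" "a \<in> S" using level_in by auto
  with no_last[of b k] ab obtain e f where "level S k e f" "b < f" unfolding last_end_def by force
  with level_cases[OF ab this(1)] level_le[OF ab] show ?thesis by force
qed

lemma exit_exists:
  assumes ab: "level S k a b"
  shows "(\<exists>c. exit_right S (level S k) b c) \<or> (\<exists>e. exit_left S (level S k) e a)"
proof -
  obtain c0 d0 where c0: "level S k c0 d0" "b < c0" using level_right[OF ab] by blast
  define V where "V = {v \<in> S \<inter> {a - (c0 - b)..c0}. (b < v \<and> (\<exists>f. level S k v f)) \<or> (v < a \<and>
      (\<exists>e. level S k e v))}"
  define g where "g v = max (v - b) (a - v)" for v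
  have "finite (S \<inter> {a - (c0 - b)..c0})" by (rule finite_Int_bounded) simp
  then have V: "finite V" by (rule rev_finite_subset) (auto simp: V_def)
  have le: "a \<le> b" using ab level_le by auto
  have "c0 \<in> V" using c0 le level_in[OF c0(1)] by (auto simp: V_def)
  then obtain v where v: "v \<in> V" "\<And>w. w \<in> V \<Longrightarrow> g v \<le> g w"
    using V by (metis (no_types, lifting) empty_iff arg_min_least arg_min_if_finite(1))
  have gv: "g v \<le> c0 - b" using v(2)[OF \<open>c0 \<in> V\<close>] c0 le by (auto simp: g_def)
  have min: "(e = a \<and> f = b) \<or> g v \<le> a - f \<or> g v \<le> e - b" if ef: "level S k e f" for e f
  proof -
    consider "e = a \<and> f = b" | "f < a" | "b < e" using level_cases[OF ab ef] by blast
    then show ?thesis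
    proof cases
      case 2
      show ?thesis
      proof (cases "f \<in> V")
        case True
        then show ?thesis using v(2)[OF True] 2 le by (auto simp: g_def)
      next
        case False
        then have "f < a - (c0 - b) \<or> f > c0" using 2 ef level_in[OF ef] by (auto simp: V_def)
        then show ?thesis using gv 2 le c0(2) by linarith
      qed
    next
      case 3
      show ?thesis
      proof (cases "e \<in> V")
        case True
        then show ?thesis using v(2)[OF True] 3 le by (auto simp: g_def)
      next
        case False
        then have "e < a - (c0 - b) \<or> e > c0" using 3 ef level_in[OF ef] by (auto simp: V_def)
        then show ?thesis using gv 3 le c0(2) by linarith
      qed
    qed simp
  qed
  from v(1) consider f where "b < v" "level S k v f" | e where "v < a" "level S k e v"
      unfolding V_def by blast
  then show ?thesis
  proof cases
    case 1
    then have "g v = v - b" using le by (auto simp: g_def)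
    then have "exit_right S (level S k) b v" using 1 ab min by (intro exit_rightI) auto
    then show ?thesis by blast
  next
    case 2
    then have "g v = a - v" using le by (auto simp: g_def)
    then have "exit_left S (level S k) v a" using min by (intro exit_leftI[OF 2(2) ab 2(1)]) (metis)
    then show ?thesis by blast
  qed
qed

lemma link_unique: "link S k x y \<Longrightarrow> link S k x y' \<Longrightarrow> y = y'"
proof -
  have rr: "c = c'" if 0: "exit_right S (level S k) b c" "exit_right S (level S k) b c'" for b c c'
  proof -
    obtain a d where 1: "level S k a b" "level S k c d" "b < c"
      "\<And>e f. level S k e f \<Longrightarrow> (e = a \<and> f = b) \<or> c - b \<le> a - f \<or> c - b \<le> e - b"
      using exit_rightE[OF 0(1)] by blast
    from exit_right_rule[OF 0(2) 1(1)] obtain d' where 2: "level S k c' d'" "b < c'"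
      "\<And>e f. level S k e f \<Longrightarrow> (e = a \<and> f = b) \<or> c' - b \<le> a - f \<or> c' - b \<le> e - b" by blast
    show ?thesis using 1(3) 2(2) 1(4)[OF 2(1)] 2(3)[OF 1(2)] level_le[OF 1(1)] level_le[OF 1(2)] level_le[OF 2(1)]
      by linarith
  qed
  have ll: "c = c'" if 0: "exit_left S (level S k) c b" "exit_left S (level S k) c' b" for b c c'
  proof -
    obtain a d where 1: "level S k a c" "level S k b d" "c < b"
      "\<And>e f. level S k e f \<Longrightarrow> (e = b \<and> f = d) \<or> b - c \<le> e - d \<or> b - c \<le> b - f"
      using exit_leftE[OF 0(1)] by blast
    from exit_left_rule[OF 0(2) 1(2)] obtain a' where 2: "level S k a' c'" "c' < b"
      "\<And>e f. level S k e f \<Longrightarrow> (e = b \<and> f = d) \<or> b - c' \<le> e - d \<or> b - c' \<le> b - f" by blast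
    show ?thesis using 1(3) 2(2) 1(4)[OF 2(1)] 2(3)[OF 1(1)] level_le[OF 1(1)] level_le[OF 1(2)] level_le[OF 2(1)]
      by linarith
  qed
  have rl: False if 0: "exit_right S (level S k) b c" "exit_left S (level S k) e b" for b c e
  proof -
    obtain a where a: "level S k a b" using exit_rightE[OF 0(1)] by blast
    obtain d where d: "level S k b d" using exit_leftE[OF 0(2)] by blast
    have "a = b \<and> b = d" using level_cases[OF a d] level_le[OF a] level_le[OF d] by linarith
    then show False using exit_both[of k b b c e] a 0 by simp
  qed
  assume "link S k x y" "link S k x y'"
  then show "y = y'" unfolding link_def using rr ll rl by blast
qed

lemma level_Suc_iff: "level S (Suc k) b c \<longleftrightarrow> b < c \<and> link S k b c \<and> link S k c b"
  by (auto simp: link_def exit_right_def exit_left_def)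

definition ends :: "nat \<Rightarrow> real set" where
  "ends k = {x. \<exists>y. level S k x y \<or> level S k y x}"

lemma link_ends: "link S k x y \<Longrightarrow> x \<in> ends k \<and> y \<in> ends k"
  unfolding link_def exit_right_def exit_left_def ends_def by blast

lemma ends_Suc_link: "x \<in> ends (Suc k) \<Longrightarrow> \<exists>y. link S k x y \<and> link S k y x"
  unfolding ends_def level_Suc_iff by blast

lemma ends_antimono: "j \<le> k \<Longrightarrow> ends k \<subseteq> ends j"
proof (induction k rule: dec_induct)
  case (step k)
  then show ?case using ends_Suc_link link_ends by blast
qed simp

lemma link_only_one: "level S (Suc k) a b \<Longrightarrow> link S (Suc k) a y \<Longrightarrow> \<not> link S (Suc k) b z"
proof
  assume ab: "level S (Suc k) a b" and a: "link S (Suc k) a y" and b: "link S (Suc k) b z"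
  note lt = level_less[OF ab]
  have "exit_left S (level S (Suc k)) y a"
  proof (rule ccontr)
    assume "\<not> ?thesis"
    then have "exit_right S (level S (Suc k)) a y" using a by (simp add: link_def)
    then obtain a' where "level S (Suc k) a' a" using exit_rightE by metis
    from level_cases[OF ab this] level_less[OF this] lt show False by linarith
  qed
  moreover have "exit_right S (level S (Suc k)) b z"
  proof (rule ccontr)
    assume "\<not> ?thesis"
    then have "exit_left S (level S (Suc k)) z b" using b by (simp add: link_def)
    then obtain a' where "level S (Suc k) b a'" using exit_leftE by metis
    from level_cases[OF ab this] level_less[OF this] lt show False by linarith
  qed
  ultimately show False using exit_both[OF ab] by blast
qed

lemma linked_refl [simp]: "(x, x) \<in> linked S k"
  by (simp add: linked_def)

lemma linked_trans: "(x, y) \<in> linked S k \<Longrightarrow> (y, z) \<in> linked S k \<Longrightarrow> (x, z) \<in> linked S k"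
  unfolding linked_def by (rule rtrancl_trans)

lemma linked_sym: "(x, y) \<in> linked S k \<Longrightarrow> (y, x) \<in> linked S k"
  unfolding linked_def by (rule symD[OF sym_rtrancl]) (auto simp: sym_def)

lemma linked_mono: "j \<le> k \<Longrightarrow> (x, y) \<in> linked S j \<Longrightarrow> (x, y) \<in> linked S k"
proof -
  assume "j \<le> k" "(x, y) \<in> linked S j"
  then show ?thesis unfolding linked_def
    by (elim rtrancl_mono[THEN subsetD, rotated]) (auto intro: less_le_trans)
qed

lemma linkedI: "link S j x y \<Longrightarrow> j < k \<Longrightarrow> (x, y) \<in> linked S k"
  unfolding linked_def by (rule r_into_rtrancl) auto

lemma linked_in: "(x, y) \<in> linked S k \<Longrightarrow> x \<in> S \<Longrightarrow> y \<in> S"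
  unfolding linked_def by (induction rule: rtrancl_induct) (auto dest: link_in)

lemma level_linked: "level S k a b \<Longrightarrow> (a, b) \<in> linked S k"
proof (cases k)
  case (Suc j)
  assume "level S k a b"
  then show ?thesis using linkedI[of j a b k] unfolding Suc level_Suc_iff by blast
qed auto

lemma linked_convex_if_edges:
  assumes edges: "\<And>j x y z. j < k \<Longrightarrow> link S j x y \<Longrightarrow> z \<in> S \<Longrightarrow> min x y < z \<Longrightarrow> z < max x y \<Longrightarrow>
      (x, z) \<in> linked S k"
    and "(x, y) \<in> linked S k" "z \<in> S" "min x y \<le> z" "z \<le> max x y"
  shows "(x, z) \<in> linked S k"
proof -
  have "\<forall>z\<in>S. min x y \<le> z \<and> z \<le> max x y \<longrightarrow> (x, z) \<in> linked S k"
    using assms(2)[unfolded linked_def]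
  proof (induction rule: rtrancl_induct)
    case base
    then show ?case by auto
  next
    case (step y y')
    have xy: "(x, y) \<in> linked S k" using step(1) by (simp add: linked_def)
    have yy': "(y, y') \<in> linked S k" using step(2) unfolding linked_def by (rule r_into_rtrancl)
    have between: "(y, z) \<in> linked S k" if zz: "z \<in> S" "min y y' \<le> z" "z \<le> max y y'" for z
    proof -
      obtain j where j: "j < k" "link S j y y' \<or> link S j y' y" using step(2) by auto
      consider "z = y" | "z = y'" | "min y y' < z" "z < max y y'" using zz by linarith
      then show ?thesis
      proof cases
        case 3
        show ?thesis
        proof (cases "link S j y y'")
          case True
          then show ?thesis using edges[OF j(1) True zz(1)] 3 by simp
        next
          case False
          then have "link S j y' y" using j by simp
          then have "(y', z) \<in> linked S k" using edges[OF j(1) _ zz(1)] 3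
              by (simp add: min.commute max.commute)
          then show ?thesis using yy' linked_trans by blast
        qed
      qed (use yy' in auto)
    qed
    show ?case
    proof (intro ballI impI)
      fix z assume z: "z \<in> S" "min x y' \<le> z \<and> z \<le> max x y'"
      then consider "min x y \<le> z \<and> z \<le> max x y" | "min y y' \<le> z" "z \<le> max y y'" by linarith
      then show "(x, z) \<in> linked S k"
      proof cases
        case 1
        then show ?thesis using step.IH z by blast
      next
        case 2
        then show ?thesis using between[OF z(1)] xy linked_trans by blast
      qed
    qed
  qed
  then show ?thesis using assms by blast
qed

lemma link_gap_free: "link S k x y \<Longrightarrow> level S k e f \<Longrightarrow> f \<le> min x y \<or> max x y \<le> e"
proof -
  assume l: "link S k x y" and ef: "level S k e f"
  have le: "e \<le> f" using ef by (rule level_le)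
  from l consider "exit_right S (level S k) x y" | "exit_left S (level S k) y x" by (auto simp: link_def)
  then show ?thesis
  proof cases
    case 1
    then obtain a d where *: "level S k a x" "level S k y d" "x < y"
      "\<And>e f. level S k e f \<Longrightarrow> (e = a \<and> f = x) \<or> y - x \<le> a - f \<or> y - x \<le> e - x" by (rule exit_rightE) blast
    show ?thesis using *(3) *(4)[OF ef] level_le[OF *(1)] by linarith
  next
    case 2
    then obtain a d where *: "level S k a y" "level S k x d" "y < x"
      "\<And>e f. level S k e f \<Longrightarrow> (e = x \<and> f = d) \<or> x - y \<le> e - d \<or> x - y \<le> x - f" by (rule exit_leftE) blast
    show ?thesis using *(3) *(4)[OF ef] level_le[OF *(2)] by linarith
  qed
qed

abbreviation "convex_links k \<equiv> (\<forall>x y z. (x, y) \<in> linked S k \<longrightarrow> x \<in> S \<longrightarrow> z \<in> S \<longrightarrow> min x y \<le> z \<longrightarrow>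
    z \<le> max x y \<longrightarrow> (x, z) \<in> linked S k)"
abbreviation "finite_classes_have_level k \<equiv> (\<forall>x\<in>S. finite (linked S k `` {x}) \<longrightarrow>
    (\<exists>a b. level S k a b \<and> (x, a) \<in> linked S k))"

lemma link_min_mutual:
  assumes l: "link S k u v" and uv: "\<And>u' v'. link S k u' v' \<Longrightarrow> (v, u') \<in> linked S k \<Longrightarrow> \<bar>u - v\<bar> \<le> \<bar>u' - v'\<bar>"
  shows "link S k v u"
proof -
  have bound: "\<bar>u - v\<bar> \<le> \<bar>u' - v'\<bar>" if "link S k u' v'" "u' = e \<or> u' = f" "v = e \<or> v = f"
      "level S k e f" for u' v' e f
    using uv[OF that(1)] that level_linked[OF that(4)] linked_sym[OF level_linked[OF that(4)]] by auto
  have *: "(e' = e \<and> f' = f) \<or> \<bar>u - v\<bar> \<le> e - f' \<or> \<bar>u - v\<bar> \<le> e' - f"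
    if ef: "level S k e f" and v: "v = e \<or> v = f" and ef': "level S k e' f'" for e f e' f'
    using exit_exists[OF ef]
  proof
    assume "\<exists>c. exit_right S (level S k) f c"
    then obtain c where c: "exit_right S (level S k) f c" by blast
    then have "\<bar>u - v\<bar> \<le> \<bar>f - c\<bar>" using bound[of f c e f] ef v by (auto simp: link_def)
    then show ?thesis using exit_right_rule[OF c ef] ef' by (smt (verit))
  next
    assume "\<exists>c. exit_left S (level S k) c e"
    then obtain c where c: "exit_left S (level S k) c e" by blast
    then have "\<bar>u - v\<bar> \<le> \<bar>e - c\<bar>" using bound[of e c e f] ef v by (auto simp: link_def)
    then show ?thesis using exit_left_rule[OF c ef] ef' by (smt (verit))
  qed
  from l consider "exit_right S (level S k) u v" | "exit_left S (level S k) v u" by (auto simp: link_def)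
  then show ?thesis
  proof cases
    case 1
    then obtain a d where 2: "level S k a u" "level S k v d" "u < v" by (rule exit_rightE)
    then have "exit_left S (level S k) u v"
      using *[OF 2(2)] by (intro exit_leftI[OF 2]) force
    then show ?thesis by (simp add: link_def)
  next
    case 2
    then obtain a d where 2: "level S k a v" "level S k u d" "v < u" by (rule exit_leftE)
    then have "exit_right S (level S k) v u"
      using *[OF 2(1)] by (intro exit_rightI[OF 2]) force
    then show ?thesis by (simp add: link_def)
  qed
qed

lemma convex_and_level: "convex_links k \<and> finite_classes_have_level k"
proof (induction k)
  case 0
  have "linked S 0 = Id" by (auto simp: linked_def)
  then show ?case by auto
next
  case (Suc k)
  then have conv: "\<And>x y z. (x, y) \<in> linked S k \<Longrightarrow> x \<in> S \<Longrightarrow> z \<in> S \<Longrightarrow> min x y \<le> z \<Longrightarrow> z \<le> max x y \<Longrightarrow>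
      (x, z) \<in> linked S k"
    and lev: "\<And>x. x \<in> S \<Longrightarrow> finite (linked S k `` {x}) \<Longrightarrow> \<exists>a b. level S k a b \<and> (x, a) \<in> linked S k"
        by blast+
  have edge: "(x, z) \<in> linked S (Suc k)" if j: "j < Suc k" and l: "link S j x y" and z: "z \<in> S"
      "min x y < z" "z < max x y" for j x y z
  proof (cases "j = k")
    case False
    with j have "j < k" by simp
    then have "(x, z) \<in> linked S k" using conv[OF linkedI[OF l]] link_in[OF l] z by auto
    then show ?thesis using linked_mono[of k "Suc k"] by simp
  next
    case True
    note l = l[unfolded True]
    have "\<exists>w. (z, w) \<in> linked S k \<and> (w \<le> min x y \<or> max x y \<le> w)"
    proof (cases "finite (linked S k `` {z})")
      case True
      then obtain a b where ab: "level S k a b" "(z, a) \<in> linked S k" using lev z by blast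
      then have "(z, b) \<in> linked S k" using level_linked linked_trans by blast
      then show ?thesis using link_gap_free[OF l ab(1)] ab(2) by blast
    next
      case False
      have "finite (S \<inter> {min x y..max x y})" by (rule finite_Int_bounded) simp
      then have "\<not> linked S k `` {z} \<subseteq> S \<inter> {min x y..max x y}" using False finite_subset by blast
      then obtain w where "(z, w) \<in> linked S k" "w \<notin> S \<inter> {min x y..max x y}" by blast
      then show ?thesis using linked_in[of z w k] z(1) by force
    qed
    then obtain w where w: "(z, w) \<in> linked S k" "w \<le> min x y \<or> max x y \<le> w" by blast
    have "(z, min x y) \<in> linked S k \<or> (z, max x y) \<in> linked S k"
      using w(2)
    proof
      assume "w \<le> min x y"
      then have "(z, min x y) \<in> linked S k" using w(1) z link_in[OF l]
          by (intro conv[OF w(1)]) (auto simp: min_def)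
      then show ?thesis by blast
    next
      assume "max x y \<le> w"
      then have "(z, max x y) \<in> linked S k" using w(1) z link_in[OF l]
          by (intro conv[OF w(1)]) (auto simp: max_def)
      then show ?thesis by blast
    qed
    then have "(z, x) \<in> linked S k \<or> (z, y) \<in> linked S k"
        by (auto simp: min_def max_def split: if_splits)
    then have "(z, x) \<in> linked S (Suc k) \<or> (z, y) \<in> linked S (Suc k)"
        using linked_mono[of k "Suc k"] by auto
    then show ?thesis using linkedI[OF l, of "Suc k"] linked_sym linked_trans by blast
  qed
  have "convex_links (Suc k)"
    using linked_convex_if_edges[of "Suc k"] edge by blast
  moreover have "finite_classes_have_level (Suc k)"
  proof (intro ballI impI)
    fix x assume x: "x \<in> S" and finC: "finite (linked S (Suc k) `` {x})"
    let ?C = "linked S (Suc k) `` {x}"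
    have mono: "(u, v) \<in> linked S k \<Longrightarrow> (u, v) \<in> linked S (Suc k)" for u v
      using linked_mono[of k "Suc k"] by simp
    have "finite (linked S k `` {x})" using finC by (rule rev_finite_subset) (use mono in auto)
    then obtain a b where ab: "level S k a b" "(x, a) \<in> linked S k" using lev x by blast
    then have abC: "a \<in> ?C" "b \<in> ?C" using linked_trans[OF ab(2) level_linked[OF ab(1)]] mono by blast+
    define E where "E = {(u, v). u \<in> ?C \<and> link S k u v}"
    have E_sub: "E \<subseteq> ?C \<times> ?C"
    proof
      fix p assume "p \<in> E"
      then obtain u v where p: "p = (u, v)" "u \<in> ?C" "link S k u v" by (auto simp: E_def)
      then have "v \<in> ?C" using linkedI[OF p(3), of "Suc k"] linked_trans by blast
      then show "p \<in> ?C \<times> ?C" using p by auto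
    qed
    then have "finite E" using finC finite_subset by blast
    moreover have "E \<noteq> {}"
      using exit_exists[OF ab(1)] abC by (auto simp: E_def link_def)
    ultimately obtain p where p: "p \<in> E" "\<And>q. q \<in> E \<Longrightarrow> \<bar>fst p - snd p\<bar> \<le> \<bar>fst q - snd q\<bar>"
      using arg_min_if_finite(1)[of E "\<lambda>q. \<bar>fst q - snd q\<bar>"] arg_min_least[of E _ "\<lambda>q. \<bar>fst q - snd q\<bar>"] by blast
    obtain u v where uv: "p = (u, v)" by (cases p)
    have l: "link S k u v" and uC: "u \<in> ?C" and vC: "v \<in> ?C" using p(1) E_sub by (auto simp: E_def uv)
    have "link S k v u"
    proof (rule link_min_mutual[OF l])
      fix u' v' assume "link S k u' v'" "(v, u') \<in> linked S k"
      then have "u' \<in> ?C" "link S k u' v'" using vC mono linked_trans by blast+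
      then have "(u', v') \<in> E" by (simp add: E_def)
      then show "\<bar>u - v\<bar> \<le> \<bar>u' - v'\<bar>" using p(2)[of "(u', v')"] by (simp add: uv)
    qed
    moreover have "u \<noteq> v" using l by (auto simp: link_def exit_right_def exit_left_def)
    ultimately have "level S (Suc k) u v \<or> level S (Suc k) v u" using l unfolding level_Suc_iff by auto
    then show "\<exists>a b. level S (Suc k) a b \<and> (x, a) \<in> linked S (Suc k)" using uC vC by blast
  qed
  ultimately show ?case by blast
qed

lemma linked_convex:
  "(x, y) \<in> linked S k \<Longrightarrow> x \<in> S \<Longrightarrow> z \<in> S \<Longrightarrow> min x y \<le> z \<Longrightarrow> z \<le> max x y \<Longrightarrow> (x, z) \<in> linked S k"
  using convex_and_level by blast

lemma infinite_class:
  assumes x: "x \<in> S"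
  shows "infinite (\<Union>k. linked S k `` {x})"
proof
  let ?C = "\<Union>k. linked S k `` {x}"
  assume fin: "finite ?C"
  have strict: "ends (Suc (Suc k)) \<inter> ?C \<subset> ends (Suc k) \<inter> ?C" for k
  proof -
    have "finite (linked S (Suc k) `` {x})" using fin by (rule rev_finite_subset) auto
    then obtain a b where ab: "level S (Suc k) a b" "(x, a) \<in> linked S (Suc k)"
      using convex_and_level x by blast
    have "(x, b) \<in> linked S (Suc k)" using level_linked[OF ab(1)] ab(2) linked_trans by blast
    then have abC: "a \<in> ends (Suc k) \<inter> ?C" "b \<in> ends (Suc k) \<inter> ?C" using ab by (auto simp: ends_def)
    have "\<not> (a \<in> ends (Suc (Suc k)) \<and> b \<in> ends (Suc (Suc k)))"
      using ends_Suc_link link_only_one[OF ab(1)] by blast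
    moreover have "ends (Suc (Suc k)) \<subseteq> ends (Suc k)" by (rule ends_antimono) simp
    ultimately show ?thesis using abC by blast
  qed
  have "card (ends (Suc k) \<inter> ?C) + k \<le> card (ends (Suc 0) \<inter> ?C)" for k
  proof (induction k)
    case (Suc k)
    have "card (ends (Suc (Suc k)) \<inter> ?C) < card (ends (Suc k) \<inter> ?C)"
      using fin by (intro psubset_card_mono strict) simp
    then show ?case using Suc by linarith
  qed simp
  from this[of "Suc (card (ends (Suc 0) \<inter> ?C))"] show False by simp
qed

end

context generic_config
begin

lemma persistent_gap_unique_less:
  assumes "x \<in> S" "y \<in> S" "persistent_gap S x" "persistent_gap S y" "y < x"
  shows False
proof -
  obtain x' where x': "x' \<in> S" "x < x'" "\<And>z. z \<in> S \<Longrightarrow> \<not> (x < z \<and> z < x')" "\<And>k. (x, x') \<notin> linked S k"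
    using assms(3) unfolding persistent_gap_def by blast
  obtain y' where y': "y' \<in> S" "y < y'" "\<And>z. z \<in> S \<Longrightarrow> \<not> (y < z \<and> z < y')" "\<And>k. (y, y') \<notin> linked S k"
    using assms(4) unfolding persistent_gap_def by blast
  have "y' \<le> x" using y'(3)[OF assms(1)] assms(5) by simp
  have "finite (S \<inter> {y..x'})" by (rule finite_Int_bounded) simp
  then have "\<not> (\<Union>k. linked S k `` {x}) \<subseteq> S \<inter> {y..x'}"
      using infinite_class[OF assms(1)] finite_subset by blast
  then obtain k w where w: "(x, w) \<in> linked S k" "w \<notin> S \<inter> {y..x'}" by blast
  then have "w < y \<or> x' < w" using linked_in assms(1) by force
  then show False
  proof
    assume "x' < w"
    then have "(x, x') \<in> linked S k" using x' by (intro linked_convex[OF w(1) assms(1)]) auto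
    then show False using x'(4) by blast
  next
    assume "w < y"
    then have "(x, y) \<in> linked S k" "(x, y') \<in> linked S k"
      using y' assms \<open>y' \<le> x\<close> by (auto intro!: linked_convex[OF w(1) assms(1)])
    then show False using y'(4) linked_sym linked_trans by blast
  qed
qed

lemma persistent_gap_unique: "x \<in> S \<Longrightarrow> y \<in> S \<Longrightarrow> persistent_gap S x \<Longrightarrow> persistent_gap S y \<Longrightarrow> x = y"
  using persistent_gap_unique_less by (metis linorder_less_linear)

lemma all_linked_less:
  assumes "\<And>x. x \<in> S \<Longrightarrow> \<not> persistent_gap S x"
  shows "x \<in> S \<Longrightarrow> y \<in> S \<Longrightarrow> x \<le> y \<Longrightarrow> \<exists>k. (x, y) \<in> linked S k"
proof (induction "card (S \<inter> {x<..y})" arbitrary: x rule: less_induct)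
  case less
  show ?case
  proof (cases "x = y")
    case False
    have finA: "finite (S \<inter> {x<..y})" by (rule finite_Int_bounded) simp
    have ne: "S \<inter> {x<..y} \<noteq> {}" using less False by auto
    define x' where "x' = Min (S \<inter> {x<..y})"
    have x'A: "x' \<in> S \<inter> {x<..y}" unfolding x'_def using finA ne by (rule Min_in)
    have x'_le: "x' \<le> z" if "z \<in> S \<inter> {x<..y}" for z unfolding x'_def using finA that by (rule Min_le)
    have "\<not> (x < z \<and> z < x')" if "z \<in> S" for z using x'_le[of z] that x'A by force
    then obtain k where k: "(x, x') \<in> linked S k" using assms[OF less(2)] x'A
        unfolding persistent_gap_def by auto
    have "card (S \<inter> {x'<..y}) < card (S \<inter> {x<..y})"
      using finA x'A by (intro psubset_card_mono) auto
    then obtain k' where k': "(x', y) \<in> linked S k'" using less.hyps[of x'] less.prems x'A by auto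
    have "(x, y) \<in> linked S (max k k')"
      by (rule linked_trans[OF linked_mono[OF _ k] linked_mono[OF _ k']]) auto
    then show ?thesis by blast
  qed auto
qed

section \<open>Comparison with the point-shifts\<close>

lemma delta_ordered:
  assumes "a < b" "b < c" "c < d"
  shows "delta {a, b} {c, d} = c - b" "delta {c, d} {a, b} = c - b"
proof -
  have "{\<bar>x - y\<bar> | x y. x \<in> {a, b} \<and> y \<in> {c, d}} = {c - a, d - a, c - b, d - b}"
    using assms by (auto simp: abs_if) (smt (verit))+
  moreover have "{\<bar>x - y\<bar> | x y. x \<in> {c, d} \<and> y \<in> {a, b}} = {c - a, d - a, c - b, d - b}"
    using assms by (auto simp: abs_if) (smt (verit))+
  ultimately show "delta {a, b} {c, d} = c - b" "delta {c, d} {a, b} = c - b"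
    using assms unfolding delta_def by (simp_all add: min_def)
qed

lemma link_0_iff: "link S 0 x y \<longleftrightarrow> x \<in> S \<and> y \<in> S \<and> y \<noteq> x \<and> (\<forall>z\<in>S - {x}. \<bar>x - y\<bar> \<le> \<bar>x - z\<bar>)"
proof (cases "x < y")
  case True
  then have "link S 0 x y \<longleftrightarrow> x \<in> S \<and> y \<in> S \<and> (\<forall>z\<in>S. z = x \<or> y - x \<le> x - z \<or> y - x \<le> z - x)"
    unfolding link_def exit_right_def exit_left_def by auto
  also have "\<dots> \<longleftrightarrow> x \<in> S \<and> y \<in> S \<and> y \<noteq> x \<and> (\<forall>z\<in>S - {x}. \<bar>x - y\<bar> \<le> \<bar>x - z\<bar>)"
    using True by (auto simp: abs_if)
  finally show ?thesis .
next
  case False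
  then have "link S 0 x y \<longleftrightarrow> x \<in> S \<and> y \<in> S \<and> y \<noteq> x \<and> (\<forall>z\<in>S. z = x \<or> x - y \<le> z - x \<or> x - y \<le> x - z)"
    unfolding link_def exit_right_def exit_left_def by auto
  also have "\<dots> \<longleftrightarrow> x \<in> S \<and> y \<in> S \<and> y \<noteq> x \<and> (\<forall>z\<in>S - {x}. \<bar>x - y\<bar> \<le> \<bar>x - z\<bar>)"
    using False by (auto simp: abs_if)
  finally show ?thesis .
qed

lemma link_0_exists: "x \<in> S \<Longrightarrow> \<exists>y. link S 0 x y"
  using exit_exists[of 0 x x] by (auto simp: link_def)

lemma nn_eq: "link S 0 x y \<Longrightarrow> nn S x = y"
  unfolding nn_def
proof (rule the_equality)
  fix z assume "link S 0 x y" and z: "z \<in> S \<and> z \<noteq> x \<and> (\<forall>w\<in>S - {x}. \<bar>x - z\<bar> \<le> \<bar>x - w\<bar>)"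
  then show "z = y" using link_unique[of 0 x y z] by (simp add: link_0_iff)
qed (simp add: link_0_iff)

lemma exit_pt_iff:
  assumes cyc: "cycles2 S f = {{a, b} | a b. level S (Suc k) a b}"
  shows "(\<exists>P. exit_pt S f P y z) \<longleftrightarrow> link S (Suc k) y z"
proof
  assume "\<exists>P. exit_pt S f P y z"
  then obtain P Q where PQ: "P \<in> cycles2 S f" "y \<in> P" "Q \<in> cycles2 S f" "Q \<noteq> P" "z \<in> Q"
      "\<bar>y - z\<bar> = delta P Q"
    "\<And>Q'. Q' \<in> cycles2 S f \<Longrightarrow> Q' \<noteq> P \<Longrightarrow> delta P Q \<le> delta P Q'"
    unfolding exit_pt_def by blast
  obtain a b where P: "P = {a, b}" "level S (Suc k) a b" using PQ(1) cyc by auto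
  obtain c d where Q: "Q = {c, d}" "level S (Suc k) c d" using PQ(3) cyc by auto
  have ab: "a < b" and cd: "c < d" using P Q level_less by blast+
  have min: "(e = a \<and> f' = b) \<or> delta P Q \<le> a - f' \<or> delta P Q \<le> e - b"
      if ef: "level S (Suc k) e f'" for e f'
  proof -
    have "e < f'" using ef by (rule level_less)
    have mem: "{e, f'} \<in> cycles2 S f" using cyc ef by auto
    consider "e = a \<and> f' = b" | "b < e" | "f' < a" using level_cases[OF P(2) ef] by blast
    then show ?thesis
      using PQ(7)[OF mem] delta_ordered[of a b e f'] delta_ordered[of e f' a b] \<open>e < f'\<close> ab P(1)
      by cases (auto simp: doubleton_eq_iff)
  qed
  from level_cases[OF P(2) Q(2)] PQ(4) P(1) Q(1) consider "b < c" | "d < a" by blast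
  then show "link S (Suc k) y z"
  proof cases
    case 1
    have dl: "delta P Q = c - b" using delta_ordered[OF ab 1 cd] P Q by simp
    then have "y = b \<and> z = c" using PQ(2,5,6) P(1) Q(1) ab cd 1 by auto
    moreover have "exit_right S (level S (Suc k)) b c"
      using min unfolding dl by (intro exit_rightI[OF P(2) Q(2) 1]) metis
    ultimately show ?thesis by (simp add: link_def)
  next
    case 2
    have dl: "delta P Q = a - d" using delta_ordered[OF cd 2 ab] P Q by simp
    then have "y = a \<and> z = d" using PQ(2,5,6) P(1) Q(1) ab cd 2 by auto
    moreover have "exit_left S (level S (Suc k)) d a"
      using min unfolding dl by (intro exit_leftI[OF Q(2) P(2) 2]) metis
    ultimately show ?thesis by (simp add: link_def)
  qed
next
  have exit_ptI: "\<exists>P. exit_pt S f P y z"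
    if ab: "level S (Suc k) a b" and cd: "level S (Suc k) c d"
      and yz: "(b < c \<and> y = b \<and> z = c) \<or> (d < a \<and> y = a \<and> z = d)"
      and min: "\<And>e f. level S (Suc k) e f \<Longrightarrow> (e = a \<and> f = b) \<or> \<bar>y - z\<bar> \<le> a - f \<or> \<bar>y - z\<bar> \<le> e - b"
          for a b c d
  proof -
    have lt: "a < b" "c < d" using ab cd level_less by blast+
    have dl: "\<bar>y - z\<bar> = delta {a, b} {c, d}"
      using yz lt delta_ordered[of a b c d] delta_ordered[of c d a b] by auto
    have "delta {a, b} {c, d} \<le> delta {a, b} Q'" if Q': "Q' \<in> cycles2 S f" "Q' \<noteq> {a, b}" for Q'
    proof -
      obtain e f' where ef: "Q' = {e, f'}" "level S (Suc k) e f'" using Q' cyc by auto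
      have "e < f'" using ef level_less by blast
      from level_cases[OF ab ef(2)] Q' ef consider "b < e" | "f' < a" by blast
      then show ?thesis
        using min[OF ef(2)] delta_ordered[of a b e f'] delta_ordered[of e f' a b] \<open>e < f'\<close> lt ef dl yz by cases auto
    qed
    moreover have "{a, b} \<in> cycles2 S f" "{c, d} \<in> cycles2 S f" using cyc ab cd by auto
    moreover have "{c, d} \<noteq> {a, b}" using yz lt by (auto simp: doubleton_eq_iff)
    moreover have "y \<in> {a, b}" "z \<in> {c, d}" using yz by auto
    ultimately have "exit_pt S f {a, b} y z" using dl unfolding exit_pt_def
        by (intro conjI bexI[of _ "{c, d}"]) auto
    then show ?thesis by blast
  qed
  assume "link S (Suc k) y z"
  then consider "exit_right S (level S (Suc k)) y z" | "exit_left S (level S (Suc k)) z y"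
      by (auto simp: link_def)
  then show "\<exists>P. exit_pt S f P y z"
  proof cases
    case 1
    then obtain a d where *: "level S (Suc k) a y" "level S (Suc k) z d" "y < z"
      "\<And>e f. level S (Suc k) e f \<Longrightarrow> (e = a \<and> f = y) \<or> z - y \<le> a - f \<or> z - y \<le> e - y"
          by (rule exit_rightE) blast
    show ?thesis
    proof (rule exit_ptI[OF *(1,2)])
      fix e f assume "level S (Suc k) e f"
      then show "e = a \<and> f = y \<or> \<bar>y - z\<bar> \<le> a - f \<or> \<bar>y - z\<bar> \<le> e - y" using *(4)[of e f] *(3) by linarith
    qed (use *(3) in auto)
  next
    case 2
    then obtain a d where *: "level S (Suc k) a z" "level S (Suc k) y d" "z < y"
      "\<And>e f. level S (Suc k) e f \<Longrightarrow> (e = y \<and> f = d) \<or> y - z \<le> e - d \<or> y - z \<le> y - f"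
          by (rule exit_leftE) blast
    show ?thesis
    proof (rule exit_ptI[OF *(2,1)])
      fix e f assume "level S (Suc k) e f"
      then show "e = y \<and> f = d \<or> \<bar>y - z\<bar> \<le> y - f \<or> \<bar>y - z\<bar> \<le> e - d" using *(4)[of e f] *(3) by linarith
    qed (use *(3) in auto)
  qed
qed

lemma chn_step_link:
  assumes "cycles2 S f = {{a, b} | a b. level S (Suc k) a b}"
  shows "link S (Suc k) y z \<Longrightarrow> chn_step S f y = z"
    and "(\<And>z. \<not> link S (Suc k) y z) \<Longrightarrow> chn_step S f y = f y"
proof -
  note iff = exit_pt_iff[OF assms]
  show "chn_step S f y = z" if "link S (Suc k) y z"
  proof -
    have "(THE z. \<exists>P. exit_pt S f P y z) = z"
      unfolding iff using that link_unique by blast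
    moreover have "\<exists>P z. exit_pt S f P y z" using that iff by blast
    ultimately show ?thesis by (simp add: chn_step_def)
  qed
  show "chn_step S f y = f y" if "\<And>z. \<not> link S (Suc k) y z"
  proof -
    have "\<not> (\<exists>P z. exit_pt S f P y z)" using that iff by blast
    then show ?thesis by (simp add: chn_step_def)
  qed
qed

lemma cycles2_eqI:
  assumes "\<And>a b. a < b \<Longrightarrow> a \<in> S \<Longrightarrow> b \<in> S \<Longrightarrow> f a = b \<Longrightarrow> f b = a \<Longrightarrow> level S (Suc k) a b"
    and "\<And>a b. level S (Suc k) a b \<Longrightarrow> f a = b \<and> f b = a"
  shows "cycles2 S f = {{a, b} | a b. level S (Suc k) a b}"
proof (intro equalityI subsetI)
  fix P assume "P \<in> cycles2 S f"
  then obtain a b where ab: "P = {a, b}" "a \<in> S" "b \<in> S" "a \<noteq> b" "f a = b" "f b = a"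
    unfolding cycles2_def by blast
  then consider "a < b" | "b < a" by linarith
  then show "P \<in> {{a, b} | a b. level S (Suc k) a b}"
    using assms(1)[of a b] assms(1)[of b a] ab by cases (auto simp: insert_commute)
next
  fix P assume "P \<in> {{a, b} | a b. level S (Suc k) a b}"
  then obtain a b where ab: "P = {a, b}" "level S (Suc k) a b" by blast
  show "P \<in> cycles2 S f" unfolding cycles2_def mem_Collect_eq
    using assms(2)[OF ab(2)] level_less[OF ab(2)] level_in[OF ab(2)] ab(1)
    by (intro exI[of _ a] exI[of _ b]) auto
qed

lemma cycles2_chn: "cycles2 S (chn S k) = {{a, b} | a b. level S (Suc k) a b}"
proof (induction k)
  case 0
  show ?case
  proof (rule cycles2_eqI)
    fix a b assume ab: "a < b" "a \<in> S" "b \<in> S" "chn S 0 a = b" "chn S 0 b = a"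
    obtain a' b' where "link S 0 a a'" "link S 0 b b'" using ab link_0_exists by blast
    then show "level S (Suc 0) a b" using ab nn_eq unfolding level_Suc_iff by auto
  next
    fix a b assume "level S (Suc 0) a b"
    then show "chn S 0 a = b \<and> chn S 0 b = a" using nn_eq unfolding level_Suc_iff by simp
  qed
next
  case (Suc k)
  note st = chn_step_link[OF Suc.IH]
  have partner: "chn S k a = b \<and> chn S k b = a" if ab: "level S (Suc k) a b" for a b
  proof -
    have "{a, b} \<in> cycles2 S (chn S k)" using Suc.IH ab by auto
    then show ?thesis unfolding cycles2_def by (auto simp: doubleton_eq_iff)
  qed
  have mutual: "link S (Suc k) b a" if ab: "link S (Suc k) a b" "chn S (Suc k) b = a" for a b
  proof (rule ccontr)
    assume "\<not> ?thesis"
    then have "\<not> link S (Suc k) b z" for z using st(1)[of b z] ab(2) by auto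
    then have "chn S k b = a" using st(2)[of b] ab(2) by simp
    moreover have "b \<in> ends (Suc k)" using link_ends[OF ab(1)] by simp
    then obtain w where "level S (Suc k) b w \<or> level S (Suc k) w b" unfolding ends_def by auto
    ultimately have "level S (Suc k) a b \<or> level S (Suc k) b a"
        using partner[of b w] partner[of w b] by auto
    moreover have "a \<noteq> b" using ab(1) by (auto simp: link_def exit_right_def exit_left_def)
    ultimately show False using link_gap_free[OF ab(1), of a b] link_gap_free[OF ab(1), of b a] level_less[of S k a b] level_less[of S k b a] by linarith
  qed
  show ?case
  proof (rule cycles2_eqI)
    fix a b assume ab: "a < b" "a \<in> S" "b \<in> S" "chn S (Suc k) a = b" "chn S (Suc k) b = a"
    have "link S (Suc k) a b \<or> link S (Suc k) b a"
    proof (rule ccontr)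
      assume n: "\<not> ?thesis"
      then have no: "\<not> link S (Suc k) a z" "\<not> link S (Suc k) b z" for z
          using st(1)[of a z] st(1)[of b z] ab(4,5) by auto
      then have "chn S k a = b" "chn S k b = a" using st(2)[of a] st(2)[of b] ab(4,5) by auto
      then have "{a, b} \<in> cycles2 S (chn S k)" unfolding cycles2_def mem_Collect_eq
        using ab(1-3) by (intro exI[of _ a] exI[of _ b]) auto
      then obtain c d where "{a, b} = {c, d}" "level S (Suc k) c d" unfolding Suc.IH by blast
      then have "level S (Suc k) a b \<or> level S (Suc k) b a" unfolding doubleton_eq_iff by blast
      then show False using exit_exists[of "Suc k" a b] exit_exists[of "Suc k" b a] no
          unfolding link_def by blast
    qed
    then show "level S (Suc (Suc k)) a b" using mutual[of a b] mutual[of b a] ab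
        unfolding level_Suc_iff by blast
  next
    fix a b assume "level S (Suc (Suc k)) a b"
    then have "link S (Suc k) a b" "link S (Suc k) b a" unfolding level_Suc_iff by blast+
    then show "chn S (Suc k) a = b \<and> chn S (Suc k) b = a" using st(1) by simp
  qed
qed

lemma chn_link: "link S j x y \<Longrightarrow> chn S j x = y"
  using nn_eq chn_step_link(1)[OF cycles2_chn] by (cases j) auto

lemma chn_inf_eq:
  assumes "link S j x y" "\<And>i z. j < i \<Longrightarrow> \<not> link S i x z"
  shows "chn_inf S x = y"
proof -
  have *: "chn S n x = y" if "j \<le> n" for n
    using that
  proof (induction n rule: dec_induct)
    case base
    then show ?case by (rule chn_link[OF assms(1)])
  next
    case (step n)
    then show ?case using chn_step_link(2)[OF cycles2_chn, of n x] assms(2)[of "Suc n"] by simp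
  qed
  show ?thesis unfolding chn_inf_def
  proof (rule the_equality)
    show "\<exists>N. \<forall>n\<ge>N. chn S n x = y" using * by blast
    fix v assume "\<exists>N. \<forall>n\<ge>N. chn S n x = v"
    then obtain N where "\<forall>n\<ge>N. chn S n x = v" by blast
    then show "v = y" using *[of "max N j"] by simp
  qed
qed

lemma link_eff_edges:
  assumes l: "link S j x y"
  shows "(x, y) \<in> eff_edges S \<union> (eff_edges S)\<inverse>"
proof (cases "\<exists>i z. j < i \<and> link S i x z")
  case False
  then have "chn_inf S x = y" using chn_inf_eq[OF l] by blast
  then show ?thesis using link_in[OF l] unfolding eff_edges_def by auto
next
  case True
  then obtain i z where i: "j < i" "link S i x z" by blast
  have "x \<in> ends (Suc j)" using link_ends[OF i(2)] ends_antimono[of "Suc j" i] i(1) by auto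
  then obtain y' where "link S j x y'" "link S j y' x" using ends_Suc_link by blast
  then have yx: "link S j y x" using link_unique[OF l] by blast
  have "x \<noteq> y" using l by (auto simp: link_def exit_right_def exit_left_def)
  then have lev: "level S (Suc j) x y \<or> level S (Suc j) y x" using l yx unfolding level_Suc_iff by auto
  have ex: "\<exists>z. link S (Suc j) v z" if v: "link S i' v z'" "j < i'" for v i' z'
  proof (cases "i' = Suc j")
    case False
    then have "v \<in> ends (Suc (Suc j))"
        using link_ends[OF v(1)] ends_antimono[of "Suc (Suc j)" i'] v(2) by auto
    then show ?thesis using ends_Suc_link by blast
  qed (use v in auto)
  obtain z' where "link S (Suc j) x z'" using ex[OF i(2,1)] by blast
  then have "\<not> link S (Suc j) y w" for w
      using lev link_only_one[of j x y z' w] link_only_one[of j y x w z'] by blast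
  then have "chn_inf S y = x" using chn_inf_eq[OF yx] ex by blast
  then show ?thesis using link_in[OF l] unfolding eff_edges_def by auto
qed

lemma linked_eff: "(x, y) \<in> linked S k \<Longrightarrow> (x, y) \<in> (eff_edges S \<union> (eff_edges S)\<inverse>)\<^sup>*"
  unfolding linked_def
proof (erule rtrancl_mono[THEN subsetD, rotated], rule subrelI)
  fix x y assume "(x, y) \<in> {(x, y). \<exists>j<k. link S j x y \<or> link S j y x}"
  then obtain j where "link S j x y \<or> link S j y x" by blast
  then show "(x, y) \<in> eff_edges S \<union> (eff_edges S)\<inverse>" using link_eff_edges by blast
qed

lemma eff_connected_if_no_persistent_gap:
  assumes "\<And>x. x \<in> S \<Longrightarrow> \<not> persistent_gap S x"
  shows "eff_connected S"
  unfolding eff_connected_def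
proof (intro ballI)
  fix x y assume "x \<in> S" "y \<in> S"
  then have "\<exists>k. (x, y) \<in> linked S k"
    using all_linked_less[OF assms, of x y] all_linked_less[OF assms, of y x] linked_sym
        by (meson linear)
  then show "(x, y) \<in> (eff_edges S \<union> (eff_edges S)\<inverse>)\<^sup>*" using linked_eff by blast
qed

end

section \<open>Translations and measurability\<close>

lemma exit_translate:
  fixes t :: real
  assumes "\<And>a b. Q' (t + a) (t + b) = Q a b"
  shows "exit_right ((+) t ` S) Q' (t + b) (t + c) = exit_right S Q b c"
    and "exit_left ((+) t ` S) Q' (t + b) (t + c) = exit_left S Q b c"
  unfolding exit_right_def exit_left_def by (simp_all add: assms)

lemma level_translate: "level ((+) t ` S) k (t + a) (t + b) = level S k a b"
proof (induction k arbitrary: a b)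
  case 0
  then show ?case by auto
next
  case (Suc k)
  show ?case by (simp add: exit_translate[where Q = "level S k" and t = t] Suc)
qed

lemma link_translate: "link ((+) t ` S) k (t + x) (t + y) = link S k x y"
  unfolding link_def by (simp add: exit_translate[where Q = "level S k" and t = t] level_translate)

lemma linked_translate: "(t + x, t + y) \<in> linked ((+) t ` S) k \<longleftrightarrow> (x, y) \<in> linked S k"
proof -
  have *: "(t + x, t + y) \<in> linked ((+) t ` S) k" if "(x, y) \<in> linked S k" for x y t S
    using that unfolding linked_def
  proof (induction rule: rtrancl_induct)
    case (step y z)
    then have "(t + y, t + z) \<in> {(x, y). \<exists>j<k. link ((+) t ` S) j x y \<or> link ((+) t ` S) j y x}"
      by (simp add: link_translate)
    with step.IH show ?case by (rule rtrancl_into_rtrancl)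
  qed simp
  have "(+) (- t) ` (+) t ` S = S" by (simp add: image_image)
  with *[of x y S t] *[of "t + x" "t + y" "(+) t ` S" "- t"] show ?thesis by auto
qed

lemma persistent_gap_translate: "persistent_gap ((+) t ` S) (t + x) = persistent_gap S x"
  unfolding persistent_gap_def by (simp add: linked_translate)

lemma tie_translate: "tie ((+) t ` S) (t + x) = tie S x"
proof -
  have "(t + a = t + b + (t + c) - (t + d)) = (a = b + c - d)" for a b c d :: real by auto
  then show ?thesis unfolding tie_def by simp
qed

lemma last_end_translate: "last_end ((+) t ` S) k (t + x) = last_end S k x"
  unfolding last_end_def by (simp add: level_translate)

lemma locally_finite_translate: "locally_finite S \<Longrightarrow> locally_finite ((+) t ` S)"
  unfolding locally_finite_def
proof (intro allI impI)
  fix B :: "real set" assume S: "\<forall>B. bounded B \<longrightarrow> finite (S \<inter> B)" and "bounded B"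
  then have "bounded ((+) (- t) ` B)" using bounded_translation by blast
  then have "finite ((+) t ` (S \<inter> (+) (- t) ` B))" using S by blast
  moreover have "(+) t ` S \<inter> B \<subseteq> (+) t ` (S \<inter> (+) (- t) ` B)" by (force simp: image_iff)
  ultimately show "finite ((+) t ` S \<inter> B)" by (rule finite_subset[rotated])
qed

definition cell :: "nat \<Rightarrow> int \<Rightarrow> real set" where
  "cell n j = {real_of_int j / 2 ^ n ..< (real_of_int j + 1) / 2 ^ n}"

lemma cell_iff: "x \<in> cell n j \<longleftrightarrow> \<lfloor>x * 2 ^ n\<rfloor> = j"
  unfolding cell_def by (simp add: floor_eq_iff pos_divide_le_eq pos_less_divide_eq)

lemma cell_borel [measurable]: "cell n j \<in> sets borel"
  by (simp add: cell_def)

lemma cell_bounded [simp]: "bounded (cell n j)"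
  unfolding cell_def by (rule bounded_subset[OF bounded_closed_interval[of "real_of_int j / 2 ^ n"
      "(real_of_int j + 1) / 2 ^ n"]]) auto

lemma cell_nested: "n \<le> m \<Longrightarrow> x \<in> cell m i \<Longrightarrow> x \<in> cell n (i div 2 ^ (m - n))"
proof -
  assume "n \<le> m" "x \<in> cell m i"
  then have "i = \<lfloor>x * 2 ^ m\<rfloor>" by (simp add: cell_iff)
  moreover have "x * 2 ^ n = x * 2 ^ m / real_of_int (2 ^ (m - n))"
    using power_add[of "2::real" n "m - n"] \<open>n \<le> m\<close> by simp
  ultimately show ?thesis using floor_divide_real_eq_div[of "2 ^ (m - n)" "x * 2 ^ m"]
      by (simp add: cell_iff)
qed

lemma emeasure_cell: "emeasure lborel (cell n j) = ennreal (1 / 2 ^ n)"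
  unfolding cell_def by (simp add: divide_right_mono diff_divide_distrib[symmetric])

lemma measure_cell: "measure lborel (cell n j) = 1 / 2 ^ n"
  by (simp add: measure_def emeasure_cell)

definition conf :: "real set measure" where
  "conf = sigma (Collect locally_finite) {{S \<in> Collect locally_finite. card (S \<inter> cell n j) = k} | n j k. True}"

lemma space_conf [simp]: "space conf = Collect locally_finite"
  unfolding conf_def by (simp add: space_measure_of_conv)

lemma sets_conf: "sets conf = sigma_sets (Collect locally_finite) {{S \<in> Collect locally_finite. card (S \<inter> cell n j) = k} | n j k. True}"
  unfolding conf_def by (rule sets_measure_of) auto

lemma count_cell_measurable [measurable]: "(\<lambda>S. card (S \<inter> cell n j)) \<in> measurable conf (count_space UNIV)"
proof (rule measurable_count_space_eq2_countable[THEN iffD2], intro conjI)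
  show "\<forall>a\<in>UNIV. (\<lambda>S. card (S \<inter> cell n j)) -` {a} \<inter> space conf \<in> sets conf"
  proof
    fix k
    have "(\<lambda>S. card (S \<inter> cell n j)) -` {k} \<inter> space conf = {S \<in> Collect locally_finite. card (S \<inter> cell n j) = k}" by auto
    then show "(\<lambda>S. card (S \<inter> cell n j)) -` {k} \<inter> space conf \<in> sets conf"
      unfolding sets_conf by (auto intro: sigma_sets.Basic)
  qed
qed auto

lemma finite_cell: "locally_finite S \<Longrightarrow> finite (S \<inter> cell n j)"
  unfolding locally_finite_def by simp

lemma measurable_into_conf:
  assumes "\<And>x. x \<in> space M \<Longrightarrow> locally_finite (f x)"
    and "\<And>n j. (\<lambda>x. card (f x \<inter> cell n j)) \<in> measurable M (count_space UNIV)"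
  shows "f \<in> measurable M conf"
  unfolding conf_def
proof (rule measurable_measure_of)
  fix A assume "A \<in> {{S \<in> Collect locally_finite. card (S \<inter> cell n j) = k} | n j k. True}"
  then obtain n j k where A: "A = {S \<in> Collect locally_finite. card (S \<inter> cell n j) = k}" by blast
  have "f -` A \<inter> space M = (\<lambda>x. card (f x \<inter> cell n j)) -` {k} \<inter> space M"
    using assms(1) by (auto simp: A)
  then show "f -` A \<inter> space M \<in> sets M" using measurable_sets[OF assms(2), of "{k}"] by simp
qed (use assms in auto)

definition first_in :: "nat \<Rightarrow> int \<Rightarrow> real set \<Rightarrow> real" where
  "first_in n j S = (if S \<inter> cell n j = {} then 0 else Min (S \<inter> cell n j))"

lemma ex_small_cell: "\<delta> > 0 \<Longrightarrow> \<exists>n\<ge>n0. 1 / 2 ^ n < (\<delta> :: real)"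
proof -
  assume "\<delta> > 0"
  then obtain n where n: "(1 / 2) ^ n < \<delta>" using real_arch_pow_inv[of \<delta> "1/2"] by auto
  have "(1 / 2 :: real) ^ max n n0 \<le> (1 / 2) ^ n" by (rule power_decreasing) auto
  then show ?thesis using n by (intro exI[of _ "max n n0"]) (auto simp: power_one_over)
qed

lemma cell_width: "x \<in> cell n j \<Longrightarrow> y \<in> cell n j \<Longrightarrow> \<bar>x - y\<bar> < 1 / 2 ^ n"
  unfolding cell_def by (auto simp: add_divide_distrib abs_if)

lemma ex_isolating_cell:
  assumes "locally_finite S" "x \<in> S"
  shows "\<exists>n\<ge>n0. S \<inter> cell n \<lfloor>x * 2 ^ n\<rfloor> = {x}"
proof -
  have "finite (S \<inter> {x - 1..x + 1})" using assms(1) by (simp add: locally_finite_def)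
  from finite_set_avoid[OF this, of x]
  obtain d where d: "d > 0" "\<And>y. y \<in> S \<inter> {x - 1..x + 1} \<Longrightarrow> y \<noteq> x \<Longrightarrow> d \<le> dist x y" by metis
  have "min d 1 > 0" using d(1) by simp
  then obtain n where n: "n \<ge> n0" "1 / 2 ^ n < min d 1" using ex_small_cell by blast
  have "y = x" if "y \<in> S" "y \<in> cell n \<lfloor>x * 2 ^ n\<rfloor>" for y
  proof (rule ccontr)
    assume "y \<noteq> x"
    have "\<bar>x - y\<bar> < 1 / 2 ^ n" by (rule cell_width[OF _ that(2)]) (simp add: cell_iff)
    then have "\<bar>x - y\<bar> < d" "y \<in> {x - 1..x + 1}" using n(2) unfolding atLeastAtMost_iff by linarith+
    then show False using d(2)[of y] that \<open>y \<noteq> x\<close> by (auto simp: dist_real_def)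
  qed
  moreover have "x \<in> cell n \<lfloor>x * 2 ^ n\<rfloor>" by (simp add: cell_iff)
  ultimately show ?thesis using assms(2) n(1) by blast
qed

lemma bex_first_in:
  assumes "locally_finite S"
  shows "(\<exists>x\<in>S. P x) \<longleftrightarrow> (\<exists>n j. card (S \<inter> cell n j) \<noteq> 0 \<and> P (first_in n j S))"
proof
  assume "\<exists>x\<in>S. P x"
  then obtain x where x: "x \<in> S" "P x" by blast
  obtain n where "S \<inter> cell n \<lfloor>x * 2 ^ n\<rfloor> = {x}" using ex_isolating_cell[OF assms x(1)] by blast
  then show "\<exists>n j. card (S \<inter> cell n j) \<noteq> 0 \<and> P (first_in n j S)"
    using x(2) by (intro exI[of _ n] exI[of _ "\<lfloor>x * 2 ^ n\<rfloor>"]) (simp add: first_in_def)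
next
  assume "\<exists>n j. card (S \<inter> cell n j) \<noteq> 0 \<and> P (first_in n j S)"
  then obtain n j where nj: "card (S \<inter> cell n j) \<noteq> 0" "P (first_in n j S)" by blast
  then have "S \<inter> cell n j \<noteq> {}" by auto
  then have "first_in n j S \<in> S" using Min_in[OF finite_cell[OF assms]] by (simp add: first_in_def)
  then show "\<exists>x\<in>S. P x" using nj by blast
qed

lemma first_in_measurable [measurable]: "first_in n j \<in> borel_measurable conf"
proof (rule borel_measurableI_less)
  fix x :: real
  have "first_in n j S < x \<longleftrightarrow> (if card (S \<inter> cell n j) = 0 then 0 < x else
     (\<exists>m i. n \<le> m \<and> i div 2 ^ (m - n) = j \<and> (real_of_int i + 1) / 2 ^ m \<le> x \<and> card (S \<inter> cell m i) \<noteq> 0))"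
    (is "_ \<longleftrightarrow> ?R") if S: "locally_finite S" for S
  proof (cases "S \<inter> cell n j = {}")
    case True
    then show ?thesis by (simp add: first_in_def)
  next
    case False
    note fin = finite_cell[OF S]
    let ?p = "Min (S \<inter> cell n j)"
    have p: "?p \<in> S" "?p \<in> cell n j" using Min_in[OF fin False] by auto
    have "?p < x \<longleftrightarrow> (\<exists>m i. n \<le> m \<and> i div 2 ^ (m - n) = j \<and> (real_of_int i + 1) / 2 ^ m \<le> x \<and>
        card (S \<inter> cell m i) \<noteq> 0)"
    proof
      assume "?p < x"
      then obtain m where m: "m \<ge> n" "1 / 2 ^ m < x - ?p" using ex_small_cell[of "x - ?p" n] by auto
      let ?i = "\<lfloor>?p * 2 ^ m\<rfloor>"
      have i: "?p \<in> cell m ?i" by (simp add: cell_iff)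
      then have "real_of_int ?i / 2 ^ m \<le> ?p" unfolding cell_def by simp
      then have "(real_of_int ?i + 1) / 2 ^ m \<le> x" using m(2) by (simp add: add_divide_distrib)
      moreover have "?i div 2 ^ (m - n) = j" using cell_nested[OF m(1) i] p(2) by (simp add: cell_iff)
      moreover have "card (S \<inter> cell m ?i) \<noteq> 0" using fin i p(1) by auto
      ultimately show "\<exists>m i. n \<le> m \<and> i div 2 ^ (m - n) = j \<and> (real_of_int i + 1) / 2 ^ m \<le> x \<and>
          card (S \<inter> cell m i) \<noteq> 0"
        using m(1) by blast
    next
      assume "\<exists>m i. n \<le> m \<and> i div 2 ^ (m - n) = j \<and> (real_of_int i + 1) / 2 ^ m \<le> x \<and>
          card (S \<inter> cell m i) \<noteq> 0"
      then obtain m i where mi: "n \<le> m" "i div 2 ^ (m - n) = j" "(real_of_int i + 1) / 2 ^ m \<le> x"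
          "card (S \<inter> cell m i) \<noteq> 0" by blast
      then obtain y where y: "y \<in> S" "y \<in> cell m i" by (metis Int_iff card.empty ex_in_conv)
      then have "y \<in> cell n j" using cell_nested[OF mi(1) y(2)] mi(2) by simp
      then have "?p \<le> y" using fin y(1) by (intro Min_le) auto
      also have "y < x" using y(2) mi(3) unfolding cell_def by auto
      finally show "?p < x" .
    qed
    then show ?thesis using False fin by (simp add: first_in_def)
  qed
  then have "{S \<in> space conf. first_in n j S < x} = {S \<in> space conf. (if card (S \<inter> cell n j) = 0 then 0 < x else
     (\<exists>m i. n \<le> m \<and> i div 2 ^ (m - n) = j \<and> (real_of_int i + 1) / 2 ^ m \<le> x \<and> card (S \<inter> cell m i) \<noteq> 0))}"
    unfolding space_conf by (intro Collect_cong conj_cong refl) simp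
  also have "\<dots> \<in> sets conf" by measurable
  finally show "{S \<in> space conf. first_in n j S < x} \<in> sets conf" .
qed

lemma pred_bex_point:
  assumes "\<And>h. h \<in> borel_measurable conf \<Longrightarrow> Measurable.pred conf (\<lambda>S. P S (h S))"
  shows "Measurable.pred conf (\<lambda>S. \<exists>x\<in>S. P S x)"
proof -
  have [measurable]: "Measurable.pred conf (\<lambda>S. P S (first_in n j S))" for n j
    by (rule assms) measurable
  have "Measurable.pred conf (\<lambda>S. \<exists>n j. card (S \<inter> cell n j) \<noteq> 0 \<and> P S (first_in n j S))" by measurable
  then show ?thesis by (rule measurable_cong[THEN iffD1, rotated]) (simp add: bex_first_in)
qed

lemma pred_logic:
  assumes "Measurable.pred conf P" "Measurable.pred conf Q"
  shows "Measurable.pred conf (\<lambda>S. P S \<and> Q S)" "Measurable.pred conf (\<lambda>S. P S \<or> Q S)"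
    "Measurable.pred conf (\<lambda>S. P S \<longrightarrow> Q S)"
  using assms by measurable

lemma pred_neg: "Measurable.pred conf P \<Longrightarrow> Measurable.pred conf (\<lambda>S. \<not> P S)"
  by measurable

lemma pred_ball_point:
  assumes "\<And>h. h \<in> borel_measurable conf \<Longrightarrow> Measurable.pred conf (\<lambda>S. P S (h S))"
  shows "Measurable.pred conf (\<lambda>S. \<forall>x\<in>S. P S x)"
proof -
  have "Measurable.pred conf (\<lambda>S. \<not> (\<exists>x\<in>S. \<not> P S x))"
    using assms by (intro pred_neg pred_bex_point)
  then show ?thesis by simp
qed

lemma pred_compare:
  fixes f g :: "real set \<Rightarrow> real"
  assumes "f \<in> borel_measurable conf" "g \<in> borel_measurable conf"
  shows "Measurable.pred conf (\<lambda>S. f S < g S)" "Measurable.pred conf (\<lambda>S. f S \<le> g S)"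
    "Measurable.pred conf (\<lambda>S. f S = g S)"
  using assms by measurable

lemmas pred_point_intros = pred_logic pred_neg pred_bex_point pred_ball_point pred_compare
  borel_measurable_diff borel_measurable_add

lemma pred_member_point:
  assumes "f \<in> borel_measurable conf"
  shows "Measurable.pred conf (\<lambda>S. f S \<in> S)"
proof -
  have "Measurable.pred conf (\<lambda>S. \<exists>x\<in>S. x = f S)"
    using assms by (intro pred_point_intros)
  then show ?thesis by simp
qed

lemma exit_measurable:
  assumes "\<And>f g. f \<in> borel_measurable conf \<Longrightarrow> g \<in> borel_measurable conf \<Longrightarrow>
      Measurable.pred conf (\<lambda>S. Q S (f S) (g S))"
    and "f \<in> borel_measurable conf" "g \<in> borel_measurable conf"
  shows "Measurable.pred conf (\<lambda>S. exit_right S (Q S) (f S) (g S))"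
    and "Measurable.pred conf (\<lambda>S. exit_left S (Q S) (f S) (g S))"
  unfolding exit_right_def exit_left_def by ((intro pred_point_intros assms | assumption)+)

lemma level_measurable:
  assumes "f \<in> borel_measurable conf" "g \<in> borel_measurable conf"
  shows "Measurable.pred conf (\<lambda>S. level S k (f S) (g S))"
  using assms
proof (induction k arbitrary: f g)
  case 0
  then show ?case unfolding level.simps by (intro pred_point_intros pred_member_point)
next
  case (Suc k)
  then show ?case unfolding level.simps by (intro pred_logic exit_measurable)
qed

lemma link_measurable:
  assumes "f \<in> borel_measurable conf" "g \<in> borel_measurable conf"
  shows "Measurable.pred conf (\<lambda>S. link S k (f S) (g S))"
  unfolding link_def by (intro pred_logic exit_measurable level_measurable assms)

lemma linked_measurable:
  assumes "f \<in> borel_measurable conf" "g \<in> borel_measurable conf"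
  shows "Measurable.pred conf (\<lambda>S. (f S, g S) \<in> linked S k)"
proof -
  define E where "E S = {(x, y). \<exists>j<k. link S j x y \<or> link S j y x}" for S
  have E: "Measurable.pred conf (\<lambda>S. (f S, g S) \<in> E S)" if "f \<in> borel_measurable conf"
      "g \<in> borel_measurable conf" for f g
    unfolding E_def mem_Collect_eq prod.case
    by (intro pred_intros_countable pred_logic link_measurable that) simp
  have "Measurable.pred conf (\<lambda>S. (f S, g S) \<in> E S ^^ n)" if "g \<in> borel_measurable conf" for n g
    using that
  proof (induction n arbitrary: g)
    case 0
    then show ?case using pred_compare(3)[OF assms(1)] by simp
  next
    case (Suc n)
    have eq: "(f S, g S) \<in> E S ^^ Suc n \<longleftrightarrow> (\<exists>z\<in>S. (f S, z) \<in> E S ^^ n \<and> (z, g S) \<in> E S)" for S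
      by (auto simp: E_def relcomp_unfold dest: link_in)
    show ?case unfolding eq
      by (intro pred_logic pred_bex_point Suc.IH E Suc.prems)
  qed
  then have "Measurable.pred conf (\<lambda>S. \<exists>n. (f S, g S) \<in> E S ^^ n)"
    using assms by (intro pred_intros_countable) auto
  then show ?thesis unfolding linked_def E_def rtrancl_power by simp
qed

lemma persistent_gap_measurable:
  assumes "f \<in> borel_measurable conf"
  shows "Measurable.pred conf (\<lambda>S. persistent_gap S (f S))"
  unfolding persistent_gap_def
  by ((intro pred_point_intros pred_intros_countable linked_measurable assms | assumption)+)

lemma tie_measurable:
  assumes "f \<in> borel_measurable conf"
  shows "Measurable.pred conf (\<lambda>S. tie S (f S))"
  unfolding tie_def by ((intro pred_point_intros assms | assumption)+)

lemma last_end_measurable: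
  assumes "f \<in> borel_measurable conf"
  shows "Measurable.pred conf (\<lambda>S. last_end S k (f S))"
  unfolding last_end_def by ((intro pred_point_intros level_measurable assms | assumption)+)

lemma locally_finite_insert: "locally_finite S \<Longrightarrow> locally_finite (insert u S)"
  unfolding locally_finite_def by (auto simp: Int_insert_left)

lemma insert_measurable: "(\<lambda>(u, S). insert u S) \<in> measurable (borel \<Otimes>\<^sub>M conf) conf"
proof (rule measurable_into_conf)
  fix n j
  have "card (insert u S \<inter> cell n j) = card (S \<inter> cell n j) + (if u \<in> cell n j \<and>
      \<not> (\<exists>n j. card (S \<inter> cell n j) \<noteq> 0 \<and> first_in n j S = u) then 1 else 0)"
    if "locally_finite S" for u S
  proof -
    have "(\<exists>n j. card (S \<inter> cell n j) \<noteq> 0 \<and> first_in n j S = u) \<longleftrightarrow> u \<in> S"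
      using bex_first_in[OF that, of "\<lambda>x. x = u"] by simp
    then show ?thesis using finite_cell[OF that, of n j] by (auto simp: Int_insert_left insert_absorb)
  qed
  then have "card ((case p of (u, S) \<Rightarrow> insert u S) \<inter> cell n j) = card (snd p \<inter> cell n j) + (if fst p \<in> cell n j \<and> \<not> (\<exists>n j. card (snd p \<inter> cell n j) \<noteq> 0 \<and> first_in n j (snd p) = fst p) then 1 else 0)"
    if "p \<in> space (borel \<Otimes>\<^sub>M conf)" for p
    using that by (cases p) (simp add: space_pair_measure)
  then show "(\<lambda>x. card ((case x of (u, S) \<Rightarrow> insert u S) \<inter> cell n j)) \<in> borel \<Otimes>\<^sub>M conf \<rightarrow>\<^sub>M count_space UNIV"
    by (subst measurable_cong) (assumption, measurable)
qed (auto simp: space_pair_measure locally_finite_insert)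

section \<open>The law of the Poisson process\<close>

definition grid :: "nat \<Rightarrow> int set" where
  "grid n = {- (int n * 2 ^ n) ..< int n * 2 ^ n}"

definition cylinder :: "nat \<Rightarrow> (int \<Rightarrow> nat) \<Rightarrow> real set set" where
  "cylinder n \<kappa> = {S \<in> Collect locally_finite. \<forall>j\<in>grid n. card (S \<inter> cell n j) = \<kappa> j}"

definition cylinders :: "nat \<Rightarrow> real set set set" where
  "cylinders e = {cylinder n \<kappa> | n \<kappa>. e \<le> n} \<union> {{}, Collect locally_finite}"

definition subcells :: "nat \<Rightarrow> nat \<Rightarrow> int \<Rightarrow> int set" where
  "subcells n m j = {j * 2 ^ (m - n) ..< (j + 1) * 2 ^ (m - n)}"

lemma finite_grid [simp]: "finite (grid n)" by (simp add: grid_def)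

lemma finite_subcells [simp]: "finite (subcells n m j)" by (simp add: subcells_def)

lemma subcells_iff: "i \<in> subcells n m j \<longleftrightarrow> i div 2 ^ (m - n) = j"
proof
  assume "i \<in> subcells n m j"
  then show "i div 2 ^ (m - n) = j"
    by (intro int_div_pos_eq[of _ _ _ "i - j * 2 ^ (m - n)"]) (auto simp: subcells_def algebra_simps)
next
  assume j: "i div 2 ^ (m - n) = j"
  have "i = j * 2 ^ (m - n) + i mod 2 ^ (m - n)" using div_mult_mod_eq[of i "2 ^ (m - n)"] j by simp
  moreover have "0 \<le> i mod 2 ^ (m - n)" "i mod 2 ^ (m - n) < 2 ^ (m - n)" by auto
  ultimately show "i \<in> subcells n m j" unfolding subcells_def
      by (simp only: atLeastLessThan_iff distrib_right mult_1) linarith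
qed

lemma card_cell_refine:
  assumes "n \<le> m" "locally_finite S"
  shows "card (S \<inter> cell n j) = (\<Sum>i\<in>subcells n m j. card (S \<inter> cell m i))"
proof -
  have "S \<inter> cell n j = (\<Union>i\<in>subcells n m j. S \<inter> cell m i)"
  proof (intro equalityI subsetI)
    fix x assume x: "x \<in> S \<inter> cell n j"
    have "x \<in> cell m \<lfloor>x * 2 ^ m\<rfloor>" by (simp add: cell_iff)
    moreover from cell_nested[OF assms(1) this] x have "\<lfloor>x * 2 ^ m\<rfloor> \<in> subcells n m j"
      by (auto simp: cell_iff subcells_iff)
    ultimately show "x \<in> (\<Union>i\<in>subcells n m j. S \<inter> cell m i)" using x by blast
  next
    fix x assume "x \<in> (\<Union>i\<in>subcells n m j. S \<inter> cell m i)"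
    then show "x \<in> S \<inter> cell n j" using cell_nested[OF assms(1)] by (auto simp: subcells_iff)
  qed
  moreover have "card (\<Union>i\<in>subcells n m j. S \<inter> cell m i) = (\<Sum>i\<in>subcells n m j. card (S \<inter> cell m i))"
    by (rule card_UN_disjoint) (auto simp: finite_cell[OF assms(2)] cell_iff)
  ultimately show ?thesis by simp
qed

lemma power_split: "n \<le> m \<Longrightarrow> (2 :: int) ^ m = 2 ^ n * 2 ^ (m - n)"
  by (simp flip: power_add)

lemma subcells_grid_bound:
  assumes "n \<le> m" "- (int m * 2 ^ n) \<le> j" "j + 1 \<le> int m * 2 ^ n"
  shows "subcells n m j \<subseteq> grid m"
proof -
  have "- (int m * 2 ^ n) * 2 ^ (m - n) \<le> j * 2 ^ (m - n)" using assms by (intro mult_right_mono) auto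
  moreover have "(j + 1) * 2 ^ (m - n) \<le> int m * 2 ^ n * 2 ^ (m - n)" using assms
      by (intro mult_right_mono) auto
  moreover have "int m * 2 ^ n * 2 ^ (m - n) = int m * 2 ^ m" using power_split[OF assms(1)] by simp
  ultimately show ?thesis unfolding subcells_def grid_def by auto
qed

lemma subcells_grid: "n \<le> m \<Longrightarrow> j \<in> grid n \<Longrightarrow> subcells n m j \<subseteq> grid m"
proof (rule subcells_grid_bound)
  assume *: "n \<le> m" "j \<in> grid n"
  have le: "int n * 2 ^ n \<le> int m * 2 ^ n" using * by (intro mult_right_mono) auto
  then show "- (int m * 2 ^ n) \<le> j" "j + 1 \<le> int m * 2 ^ n"
    using *(2) unfolding grid_def atLeastLessThan_iff by linarith+
qed

lemma cylinder_Int: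
  assumes "n \<le> m" shows "cylinder n \<kappa> \<inter> cylinder m \<kappa>' = {} \<or>
      cylinder n \<kappa> \<inter> cylinder m \<kappa>' = cylinder m \<kappa>'"
proof (rule disjCI)
  assume "cylinder n \<kappa> \<inter> cylinder m \<kappa>' \<noteq> cylinder m \<kappa>'"
  then obtain S where S: "S \<in> cylinder m \<kappa>'" "S \<notin> cylinder n \<kappa>" by blast
  show "cylinder n \<kappa> \<inter> cylinder m \<kappa>' = {}"
  proof (rule ccontr)
    assume "\<not> ?thesis"
    then obtain T where T: "T \<in> cylinder n \<kappa>" "T \<in> cylinder m \<kappa>'" by blast
    have lf: "locally_finite S" "locally_finite T" using S T by (auto simp: cylinder_def)
    have "card (S \<inter> cell n j) = \<kappa> j" if j: "j \<in> grid n" for j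
    proof -
      have "card (S \<inter> cell n j) = (\<Sum>i\<in>subcells n m j. \<kappa>' i)"
        unfolding card_cell_refine[OF assms lf(1)] using S(1) subcells_grid[OF assms j]
            by (intro sum.cong) (auto simp: cylinder_def)
      moreover have "card (T \<inter> cell n j) = (\<Sum>i\<in>subcells n m j. \<kappa>' i)"
        unfolding card_cell_refine[OF assms lf(2)] using T(2) subcells_grid[OF assms j]
            by (intro sum.cong) (auto simp: cylinder_def)
      ultimately show ?thesis using T(1) j by (simp add: cylinder_def)
    qed
    then show False using S(2) lf by (simp add: cylinder_def)
  qed
qed

lemma cylinder_subset: "cylinder n \<kappa> \<subseteq> Collect locally_finite"
  by (auto simp: cylinder_def)

lemma Int_stable_cylinders: "Int_stable (cylinders e)"
proof (rule Int_stableI)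
  fix A B assume AB: "A \<in> cylinders e" "B \<in> cylinders e"
  have cyl: "cylinder n \<kappa> \<inter> cylinder m \<kappa>' \<in> cylinders e" if "e \<le> n" "e \<le> m" for n m \<kappa> \<kappa>'
  proof -
    have "cylinder n \<kappa> \<inter> cylinder m \<kappa>' \<in> {{}, cylinder n \<kappa>, cylinder m \<kappa>'}"
      using cylinder_Int[of n m \<kappa> \<kappa>'] cylinder_Int[of m n \<kappa>' \<kappa>] linear[of n m]
          unfolding Int_commute[of "cylinder m \<kappa>'"] by blast
    then show ?thesis using that unfolding cylinders_def by blast
  qed
  consider "A = {}" | "B = {}" | "A = Collect locally_finite" | "B = Collect locally_finite"
    | n \<kappa> m \<kappa>' where "e \<le> n" "A = cylinder n \<kappa>" "e \<le> m" "B = cylinder m \<kappa>'"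
    using AB unfolding cylinders_def by blast
  then show "A \<inter> B \<in> cylinders e"
  proof cases
    case 3
    then have "A \<inter> B = B" using AB(2) cylinder_subset unfolding cylinders_def by blast
    then show ?thesis using AB by simp
  next
    case 4
    then have "A \<inter> B = A" using AB(1) cylinder_subset unfolding cylinders_def by blast
    then show ?thesis using AB by simp
  qed (auto simp: cyl, auto simp: cylinders_def)
qed

lemma cylinder_sets: "cylinder n \<kappa> \<in> sets conf"
proof -
  have "cylinder n \<kappa> = {S \<in> space conf. \<forall>j\<in>grid n. card (S \<inter> cell n j) = \<kappa> j}"
      by (simp add: cylinder_def)
  also have "\<dots> \<in> sets conf" by measurable
  finally show ?thesis .
qed

lemma cylinders_Pow: "cylinders e \<subseteq> Pow (Collect locally_finite)"
  using cylinder_subset by (auto simp: cylinders_def)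

lemma cylinders_sets: "A \<in> cylinders e \<Longrightarrow> A \<in> sets conf"
  using cylinder_sets sets.top[of conf] by (auto simp: cylinders_def)

lemma sets_conf_cylinders: "sets conf = sigma_sets (Collect locally_finite) (cylinders e)"
proof
  show "sigma_sets (Collect locally_finite) (cylinders e) \<subseteq> sets conf"
    using sets.sigma_sets_subset[of "cylinders e" conf] cylinders_sets by auto
  show "sets conf \<subseteq> sigma_sets (Collect locally_finite) (cylinders e)"
    unfolding sets_conf
  proof (rule sigma_sets_mono, rule subsetI)
    fix A assume "A \<in> {{S \<in> Collect locally_finite. card (S \<inter> cell n j) = k} | n j k. True}"
    then obtain n j k where A: "A = {S \<in> Collect locally_finite. card (S \<inter> cell n j) = k}" by blast
    define m where "m = max e (max n (nat \<bar>j\<bar> + 1))"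
    have m: "e \<le> m" "n \<le> m" "\<bar>j\<bar> + 1 \<le> int m" by (auto simp: m_def)
    have "int m * 1 \<le> int m * 2 ^ n" by (intro mult_left_mono) auto
    then have sub: "subcells n m j \<subseteq> grid m" using m(3) by (intro subcells_grid_bound m(2)) auto
    define K where "K = {\<kappa> \<in> PiE (grid m) (\<lambda>_. UNIV :: nat set). (\<Sum>i\<in>subcells n m j. \<kappa> i) = k}"
    have "A = \<Union> (cylinder m ` K)"
    proof (intro equalityI subsetI)
      fix S assume S: "S \<in> A"
      then have lf: "locally_finite S" by (simp add: A)
      let ?\<kappa> = "\<lambda>i\<in>grid m. card (S \<inter> cell m i)"
      have "(\<Sum>i\<in>subcells n m j. ?\<kappa> i) = (\<Sum>i\<in>subcells n m j. card (S \<inter> cell m i))"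
        using sub by (intro sum.cong) auto
      also have "\<dots> = k" using S card_cell_refine[OF m(2) lf, of j] by (simp add: A)
      finally have "?\<kappa> \<in> K" by (auto simp: K_def)
      moreover have "S \<in> cylinder m ?\<kappa>" using lf by (simp add: cylinder_def)
      ultimately show "S \<in> \<Union> (cylinder m ` K)" by blast
    next
      fix S assume "S \<in> \<Union> (cylinder m ` K)"
      then obtain \<kappa> where \<kappa>: "\<kappa> \<in> K" "S \<in> cylinder m \<kappa>" by blast
      then have lf: "locally_finite S" by (simp add: cylinder_def)
      have "card (S \<inter> cell n j) = (\<Sum>i\<in>subcells n m j. \<kappa> i)"
        unfolding card_cell_refine[OF m(2) lf] using \<kappa>(2) sub
            by (intro sum.cong) (auto simp: cylinder_def)
      then show "S \<in> A" using \<kappa>(1) lf by (simp add: A K_def)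
    qed
    moreover have "countable K"
      by (rule countable_subset[OF _ countable_PiE[of "grid m"
          "\<lambda>_. UNIV :: nat set"]]) (auto simp: K_def)
    moreover have "cylinder m \<kappa> \<in> sigma_sets (Collect locally_finite) (cylinders e)" for \<kappa>
      using m(1) by (intro sigma_sets.Basic) (auto simp: cylinders_def)
    ultimately show "A \<in> sigma_sets (Collect locally_finite) (cylinders e)"
      by (auto intro!: sigma_sets_UNION)
  qed
qed

locale poisson_process = prob_space M for M :: "'w measure" +
  fixes lam :: real and Phi :: "'w \<Rightarrow> real set"
  assumes pp: "poisson_pp M lam Phi"
begin

definition pois :: "nat \<Rightarrow> nat \<Rightarrow> real" where
  "pois n k = (lam * (1 / 2 ^ n)) ^ k / fact k * exp (- (lam * (1 / 2 ^ n)))"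

lemma lam_pos: "0 < lam"
  using pp by (simp add: poisson_pp_def)

lemma count_measurable:
  "B \<in> sets borel \<Longrightarrow> bounded B \<Longrightarrow> (\<lambda>\<omega>. card (Phi \<omega> \<inter> B)) \<in> measurable M (count_space UNIV)"
  using pp by (simp add: poisson_pp_def)

lemma count_prob:
  "B \<in> sets borel \<Longrightarrow> bounded B \<Longrightarrow> prob {\<omega> \<in> space M. card (Phi \<omega> \<inter> B) = k} =
     (lam * measure lborel B) ^ k / fact k * exp (- (lam * measure lborel B))"
  using pp by (simp add: poisson_pp_def)

lemma indep_counts:
  fixes I :: "nat set"
  assumes "finite I" "disjoint_family_on B I" "\<And>i. i \<in> I \<Longrightarrow> B i \<in> sets borel" "\<And>i. i \<in> I \<Longrightarrow> bounded (B i)"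
  shows "indep_vars (\<lambda>_. count_space UNIV) (\<lambda>i \<omega>. card (Phi \<omega> \<inter> B i)) I"
  using pp assms by (simp add: poisson_pp_def)

lemma locally_finite_Phi: "\<omega> \<in> space M \<Longrightarrow> locally_finite (Phi \<omega>)"
  unfolding locally_finite_def
proof (intro allI impI)
  fix B :: "real set" assume \<omega>: "\<omega> \<in> space M" and "bounded B"
  then obtain a where a: "\<And>x. x \<in> B \<Longrightarrow> norm x \<le> a" unfolding bounded_iff by blast
  have "finite (Phi \<omega> \<inter> {-a..a})" using pp \<omega> by (simp add: poisson_pp_def)
  then show "finite (Phi \<omega> \<inter> B)" by (rule rev_finite_subset) (use a in \<open>force simp: abs_le_iff\<close>)
qed

lemma Phi_measurable [measurable]: "Phi \<in> measurable M conf"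
  by (rule measurable_into_conf) (auto simp: locally_finite_Phi intro!: count_measurable)

lemma cylinder_prob: "prob {\<omega> \<in> space M. Phi \<omega> \<in> cylinder n \<kappa>} = (\<Prod>j\<in>grid n. pois n (\<kappa> j))"
proof (cases "n = 0")
  case True
  then have "{\<omega> \<in> space M. Phi \<omega> \<in> cylinder n \<kappa>} = space M"
      by (auto simp: cylinder_def grid_def locally_finite_Phi)
  then show ?thesis using True by (simp add: grid_def prob_space)
next
  case False
  define I where "I = {..<2 * n * 2 ^ n}"
  define e where "e i = int i - int n * 2 ^ n" for i
  have bij: "bij_betw e I (grid n)"
  proof (rule bij_betw_byWitness[where f' = "\<lambda>j. nat (j + int n * 2 ^ n)"])
    show "e ` I \<subseteq> grid n"
    proof safe
      fix i assume "i \<in> I"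
      then have "int i < int (2 * n * 2 ^ n)" unfolding I_def
          by (simp only: lessThan_iff of_nat_less_iff)
      then show "e i \<in> grid n" by (simp add: e_def grid_def)
    qed
    show "(\<lambda>j. nat (j + int n * 2 ^ n)) ` grid n \<subseteq> I"
      by (auto simp: grid_def I_def nat_less_iff)
  qed (auto simp: e_def grid_def)
  have disj: "disjoint_family_on (\<lambda>i. cell n (e i)) I"
    by (auto simp: disjoint_family_on_def cell_iff e_def)
  have indep: "indep_vars (\<lambda>_. count_space UNIV) (\<lambda>i \<omega>. card (Phi \<omega> \<inter> cell n (e i))) I"
    using disj by (intro indep_counts) (auto simp: I_def)
  have "0 < 2 * n * 2 ^ n" using False by simp
  then have "I \<noteq> {}" "finite I" unfolding I_def by (blast, simp)
  have cellp: "prob ((\<lambda>\<omega>. card (Phi \<omega> \<inter> cell n j)) -` {k} \<inter> space M) = pois n k" for j k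
  proof -
    have "(\<lambda>\<omega>. card (Phi \<omega> \<inter> cell n j)) -` {k} \<inter> space M = {\<omega> \<in> space M. card (Phi \<omega> \<inter> cell n j) = k}" by auto
    then show ?thesis by (simp add: count_prob measure_cell pois_def)
  qed
  have "{\<omega> \<in> space M. Phi \<omega> \<in> cylinder n \<kappa>} = (\<Inter>i\<in>I. (\<lambda>\<omega>. card (Phi \<omega> \<inter> cell n (e i))) -` {\<kappa> (e i)} \<inter> space M)"
    using \<open>I \<noteq> {}\<close> unfolding cylinder_def bij_betw_imp_surj_on[OF bij, symmetric]
        by (auto simp: locally_finite_Phi)
  also have "prob \<dots> = (\<Prod>i\<in>I. prob ((\<lambda>\<omega>. card (Phi \<omega> \<inter> cell n (e i))) -` {\<kappa> (e i)} \<inter> space M))"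
    by (rule indep_varsD_finite[OF indep \<open>I \<noteq> {}\<close> \<open>finite I\<close>]) simp
  also have "\<dots> = (\<Prod>i\<in>I. pois n (\<kappa> (e i)))" by (simp add: cellp)
  also have "\<dots> = (\<Prod>j\<in>grid n. pois n (\<kappa> j))" by (rule prod.reindex_bij_betw[OF bij])
  finally show ?thesis .
qed

lemma translate: "poisson_process M lam (\<lambda>\<omega>. (+) t ` Phi \<omega>)"
proof (unfold_locales, unfold poisson_pp_def, intro conjI allI impI ballI)
  have eq: "card ((+) t ` S \<inter> B) = card (S \<inter> (+) t -` B)" for S B
  proof -
    have "(+) t ` S \<inter> B = (+) t ` (S \<inter> (+) t -` B)" by auto
    then show ?thesis by (simp add: card_image)
  qed
  have borel: "(+) t -` B \<in> sets borel" if "B \<in> sets borel" for B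
    using measurable_sets[of "(+) t" borel borel B] that by simp
  have bdd: "bounded ((+) t -` B)" if "bounded B" for B
  proof -
    have "(+) t -` B = (+) (- t) ` B" by (force simp: image_iff)
    then show ?thesis using bounded_translation[OF that, of "- t"] by metis
  qed
  have meas: "measure lborel ((+) t -` B) = measure lborel B" if "B \<in> sets borel" for B
  proof -
    have "measure lborel B = measure (distr lborel borel ((+) t)) B" by (simp add: lborel_distr_plus)
    also have "\<dots> = measure lborel ((+) t -` B)" using that by (subst measure_distr) auto
    finally show ?thesis by simp
  qed
  show "0 < lam" by (rule lam_pos)
  { fix B :: "real set" assume B: "B \<in> sets borel \<and> bounded B"
    show "(\<lambda>\<omega>. card ((+) t ` Phi \<omega> \<inter> B)) \<in> M \<rightarrow>\<^sub>M count_space UNIV"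
      unfolding eq using B by (intro count_measurable borel bdd) auto
    show "prob {\<omega> \<in> space M. card ((+) t ` Phi \<omega> \<inter> B) = k} =
      (lam * measure lborel B) ^ k / fact k * exp (- (lam * measure lborel B))" for k
      unfolding eq using B count_prob[of "(+) t -` B" k] borel bdd meas by auto
    show "finite ((+) t ` Phi \<omega> \<inter> B)" if "\<omega> \<in> space M" for \<omega>
      using locally_finite_translate[OF locally_finite_Phi[OF that]] B by (simp add: locally_finite_def)
  }
  fix I :: "nat set" and B :: "nat \<Rightarrow> real set"
  assume *: "finite I \<and> disjoint_family_on B I \<and> (\<forall>i\<in>I. B i \<in> sets borel \<and> bounded (B i))"
  have "disjoint_family_on (\<lambda>i. (+) t -` B i) I" using * unfolding disjoint_family_on_def by blast
  then have "indep_vars (\<lambda>_. count_space UNIV) (\<lambda>i \<omega>. card (Phi \<omega> \<inter> (+) t -` B i)) I"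
    using * by (intro indep_counts borel bdd) auto
  then show "indep_vars (\<lambda>_. count_space UNIV) (\<lambda>i \<omega>. card ((+) t ` Phi \<omega> \<inter> B i)) I"
    unfolding eq .
qed

end

lemma poisson_law_unique:
  assumes "poisson_process M lam Phi" "poisson_process M lam Psi"
  shows "distr M conf Phi = distr M conf Psi"
proof -
  interpret A: poisson_process M lam Phi by fact
  interpret B: poisson_process M lam Psi by fact
  have eq: "Phi -` X \<inter> space M = {\<omega> \<in> space M. Phi \<omega> \<in> X}"
      "Psi -` X \<inter> space M = {\<omega> \<in> space M. Psi \<omega> \<in> X}" for X by auto
  show ?thesis
  proof (rule measure_eqI_generator_eq[where \<Omega> = "Collect locally_finite" and E = "cylinders 0" and A = "\<lambda>_. Collect locally_finite"])
    show "Int_stable (cylinders 0)" by (rule Int_stable_cylinders)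
    fix X assume X: "X \<in> cylinders 0"
    have "A.prob {\<omega> \<in> space M. Phi \<omega> \<in> X} = A.prob {\<omega> \<in> space M. Psi \<omega> \<in> X}"
    proof -
      from X consider "X = {}" | "X = Collect locally_finite" | n \<kappa> where "X = cylinder n \<kappa>"
          by (auto simp: cylinders_def)
      then show ?thesis
      proof cases
        case 2
        then have "{\<omega> \<in> space M. Phi \<omega> \<in> X} = space M" "{\<omega> \<in> space M. Psi \<omega> \<in> X} = space M"
          using A.locally_finite_Phi B.locally_finite_Phi by auto
        then show ?thesis by simp
      qed (simp_all add: A.cylinder_prob B.cylinder_prob A.pois_def B.pois_def)
    qed
    then show "emeasure (distr M conf Phi) X = emeasure (distr M conf Psi) X"
      using cylinders_sets[OF X] by (simp add: emeasure_distr eq A.emeasure_eq_measure)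
  next
    show "range (\<lambda>_. Collect locally_finite) \<subseteq> cylinders 0" by (auto simp: cylinders_def)
    show "emeasure (distr M conf Phi) (Collect locally_finite) \<noteq> \<infinity>"
      using sets.top[of conf] by (simp add: emeasure_distr A.emeasure_eq_measure)
    show "sets (distr M conf Phi) = sigma_sets (Collect locally_finite) (cylinders 0)"
      "sets (distr M conf Psi) = sigma_sets (Collect locally_finite) (cylinders 0)"
      using sets_conf_cylinders[of 0] by simp_all
  qed (use cylinders_Pow in auto)
qed

lemma locally_finite_countable: "locally_finite S \<Longrightarrow> countable S"
proof -
  assume S: "locally_finite S"
  have eq: "S = (\<Union>n::nat. S \<inter> {- real n..real n})"
  proof (intro equalityI subsetI)
    fix x assume "x \<in> S"
    moreover obtain n where "\<bar>x\<bar> \<le> real n" using real_arch_simple by blast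
    ultimately show "x \<in> (\<Union>n::nat. S \<inter> {- real n..real n})"
        by (auto simp: abs_le_iff intro!: exI[of _ n])
  qed auto
  have "countable (S \<inter> {- real n..real n})" for n
    using S by (simp add: locally_finite_def countable_finite)
  then show ?thesis by (subst eq) (rule countable_UN, simp_all)
qed

context poisson_process
begin

lemma AE_translate:
  assumes "Measurable.pred conf P" "AE \<omega> in M. P (Phi \<omega>)"
  shows "AE \<omega> in M. P ((+) t ` Phi \<omega>)"
proof -
  interpret T: poisson_process M lam "\<lambda>\<omega>. (+) t ` Phi \<omega>" by (rule translate)
  have law: "distr M conf (\<lambda>\<omega>. (+) t ` Phi \<omega>) = distr M conf Phi"
    by (rule poisson_law_unique[OF translate poisson_process_axioms])
  have P: "{S \<in> space conf. P S} \<in> sets conf" using assms(1) by measurable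
  have "AE S in distr M conf Phi. P S" using AE_distr_iff[OF Phi_measurable P] assms(2) by simp
  then have "AE S in distr M conf (\<lambda>\<omega>. (+) t ` Phi \<omega>). P S"
    unfolding law .
  then show ?thesis using AE_distr_iff[OF T.Phi_measurable P] by simp
qed

lemma prob_translate:
  assumes "Measurable.pred conf P"
  shows "prob {\<omega> \<in> space M. P ((+) t ` Phi \<omega>)} = prob {\<omega> \<in> space M. P (Phi \<omega>)}"
proof -
  interpret T: poisson_process M lam "\<lambda>\<omega>. (+) t ` Phi \<omega>" by (rule translate)
  have law: "distr M conf (\<lambda>\<omega>. (+) t ` Phi \<omega>) = distr M conf Phi"
    by (rule poisson_law_unique[OF translate poisson_process_axioms])
  have P: "{S \<in> space conf. P S} \<in> sets conf" using assms(1) by measurable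
  have "prob {\<omega> \<in> space M. P ((+) t ` Phi \<omega>)} = measure (distr M conf (\<lambda>\<omega>. (+) t ` Phi \<omega>)) {S \<in> space conf. P S}"
    using P T.locally_finite_Phi by (subst measure_distr) (auto intro!: arg_cong[of _ _ prob])
  also have "\<dots> = measure (distr M conf Phi) {S \<in> space conf. P S}"
    unfolding law ..
  also have "\<dots> = prob {\<omega> \<in> space M. P (Phi \<omega>)}"
    using P locally_finite_Phi by (subst measure_distr) (auto intro!: arg_cong[of _ _ prob])
  finally show ?thesis .
qed

text \<open>The probabilities that the covariant point lies in [j, j + 1) agree for all j, and these events
  are disjoint.\<close>

lemma AE_no_covariant_point:
  assumes meas: "\<And>h. h \<in> borel_measurable conf \<Longrightarrow> Measurable.pred conf (\<lambda>S. \<phi> S (h S))"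
    and trans: "\<And>t S x. \<phi> ((+) t ` S) (t + x) = \<phi> S x"
    and uniq: "\<And>S x y. locally_finite S \<Longrightarrow> x \<in> S \<Longrightarrow> y \<in> S \<Longrightarrow> \<phi> S x \<Longrightarrow> \<phi> S y \<Longrightarrow> x = y"
  shows "AE \<omega> in M. \<forall>x\<in>Phi \<omega>. \<not> \<phi> (Phi \<omega>) x"
proof -
  define A where "A j S \<longleftrightarrow> (\<exists>x\<in>S. \<phi> S x \<and> real_of_int j \<le> x \<and> x < real_of_int j + 1)" for j S
  have A_meas: "Measurable.pred conf (A j)" for j
    unfolding A_def by ((intro pred_point_intros meas borel_measurable_const | assumption)+)
  define B where "B j = {\<omega> \<in> space M. A j (Phi \<omega>)}" for j
  have B_sets: "B j \<in> events" for j
    unfolding B_def using A_meas[of j] Phi_measurable by measurable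
  have shift: "A j ((+) (real_of_int j) ` S) = A 0 S" for j S
    unfolding A_def by (auto simp: trans)
  have same: "prob (B j) = prob (B 0)" for j
    using prob_translate[OF A_meas[of j], of "real_of_int j"] by (simp add: shift B_def)
  have disj: "disjoint_family B"
    unfolding disjoint_family_on_def
  proof (intro ballI impI equals0I)
    fix i j \<omega> assume "i \<noteq> j" "\<omega> \<in> B i \<inter> B j"
    then obtain x y where xy: "\<omega> \<in> space M" "x \<in> Phi \<omega>" "y \<in> Phi \<omega>" "\<phi> (Phi \<omega>) x" "\<phi> (Phi \<omega>) y"
      "\<lfloor>x\<rfloor> = i" "\<lfloor>y\<rfloor> = j" by (auto simp: B_def A_def floor_eq_iff)
    then show False using uniq[OF locally_finite_Phi[OF xy(1)] xy(2-5)] \<open>i \<noteq> j\<close> by simp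
  qed
  have "real n * prob (B 0) \<le> 1" for n
  proof -
    have "real n * prob (B 0) = (\<Sum>i\<in>{0..<int n}. prob (B 0))" by simp
    also have "\<dots> = (\<Sum>i\<in>{0..<int n}. prob (B i))" by (intro sum.cong refl same[symmetric])
    also have "\<dots> = prob (\<Union>i\<in>{0..<int n}. B i)"
      using disj B_sets by (intro finite_measure_finite_Union[symmetric]) (auto simp: disjoint_family_on_def)
    also have "\<dots> \<le> 1" by simp
    finally show ?thesis .
  qed
  then have "\<not> 0 < prob (B 0)" by (meson not_less reals_Archimedean3)
  then have "prob (B j) = 0" for j using same[of j] measure_nonneg[of M "B 0"] by linarith
  then have "AE \<omega> in M. \<omega> \<notin> B j" for j
    using B_sets[of j] by (intro AE_not_in) (auto simp: null_sets_def emeasure_eq_measure)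
  then have "AE \<omega> in M. \<forall>j. \<omega> \<notin> B j" by (simp add: AE_all_countable)
  with AE_space show ?thesis
  proof (eventually_elim, intro ballI notI)
    fix \<omega> x assume *: "\<omega> \<in> space M" "\<forall>j. \<omega> \<notin> B j" "x \<in> Phi \<omega>" "\<phi> (Phi \<omega>) x"
    from * have "\<omega> \<in> B \<lfloor>x\<rfloor>" unfolding B_def A_def by (auto simp: floor_le_iff intro!: bexI[of _ x])
    then show False using *(2) by blast
  qed
qed

lemma AE_no_last_end: "AE \<omega> in M. \<forall>k. \<forall>x\<in>Phi \<omega>. \<not> last_end (Phi \<omega>) k x"
  unfolding AE_all_countable
proof
  fix k
  show "AE \<omega> in M. \<forall>x\<in>Phi \<omega>. \<not> last_end (Phi \<omega>) k x"
  proof (rule AE_no_covariant_point)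
    fix S x y assume "x \<in> S" "y \<in> S" "last_end S k x" "last_end S k y"
    then show "x = y" unfolding last_end_def by (meson order_antisym)
  qed (auto intro: last_end_measurable simp: last_end_translate)
qed

lemma add_point_measurable: "(\<lambda>p. insert (fst p) (Phi (snd p))) \<in> measurable (lborel \<Otimes>\<^sub>M M) conf"
proof -
  have "(\<lambda>p. (fst p, Phi (snd p))) \<in> measurable (lborel \<Otimes>\<^sub>M M) (borel \<Otimes>\<^sub>M conf)" by measurable
  from measurable_compose[OF this insert_measurable] show ?thesis by simp
qed

lemma add_point_cylinder:
  assumes e: "1 \<le> e" "e \<le> n"
  defines "J \<equiv> cell e 0"
  shows "emeasure M {\<omega> \<in> space M. card (Phi \<omega> \<inter> J) = 1 \<and> Phi \<omega> \<in> cylinder n \<kappa>} =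
    ennreal lam * emeasure (lborel \<Otimes>\<^sub>M M) {p \<in> space (lborel \<Otimes>\<^sub>M M). fst p \<in> J \<and> card (Phi (snd p) \<inter> J) = 0 \<and>
      insert (fst p) (Phi (snd p)) \<in> cylinder n \<kappa>}" (is "emeasure M ?L = _ * emeasure _ ?R")
proof -
  let ?I = "subcells e n 0"
  have "1 * 1 \<le> int n * 2 ^ e" using e by (intro mult_mono) auto
  then have I: "?I \<subseteq> grid n" using e by (intro subcells_grid_bound) auto
  have J: "card (S \<inter> J) = (\<Sum>i\<in>?I. \<kappa>' i)" if "S \<in> cylinder n \<kappa>'" for S \<kappa>'
  proof -
    have "locally_finite S" using that by (simp add: cylinder_def)
    from card_cell_refine[OF e(2) this, of 0] show ?thesis
      unfolding J_def using that I by (auto simp: cylinder_def intro!: sum.cong)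
  qed
  have cellJ: "u \<in> J" if "u \<in> cell n i" "i \<in> ?I" for u i
    using cell_nested[OF e(2) that(1)] that(2) by (simp add: subcells_iff J_def)
  have Jcell: "\<lfloor>u * 2 ^ n\<rfloor> \<in> ?I" if "u \<in> J" for u
    using cell_nested[OF e(2), of u "\<lfloor>u * 2 ^ n\<rfloor>"] that by (auto simp: subcells_iff J_def cell_iff)
  have empty: "S \<inter> J = {}" if "locally_finite S" "card (S \<inter> J) = 0" for S
    using that finite_cell[OF that(1), of e 0] by (simp add: J_def)
  show ?thesis
  proof (cases "(\<Sum>i\<in>?I. \<kappa> i) = 1")
    case False
    then have L: "?L = {}" using J by force
    have R: "?R = {}"
    proof (rule equals0I)
      fix p assume p: "p \<in> ?R"
      then have "snd p \<in> space M" by (auto simp: space_pair_measure)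
      then have "Phi (snd p) \<inter> J = {}" using empty locally_finite_Phi p by blast
      then have "insert (fst p) (Phi (snd p)) \<inter> J = {fst p}" using p by auto
      then show False using J[of "insert (fst p) (Phi (snd p))" \<kappa>] p False by simp
    qed
    show ?thesis unfolding L R by simp
  next
    case True
    then obtain i0 where i0: "i0 \<in> ?I" "\<kappa> i0 = 1" "\<And>i. i \<in> ?I \<Longrightarrow> i \<noteq> i0 \<Longrightarrow> \<kappa> i = 0"
      unfolding sum_eq_1_iff[OF finite_subcells] by metis
    let ?\<kappa> = "\<kappa>(i0 := 0)"
    have i0g: "i0 \<in> grid n" using i0 I by auto
    have same: "insert u S \<inter> cell n j = S \<inter> cell n j" if "u \<in> cell n i0" "j \<noteq> i0" for u S j
      using that by (auto simp: cell_iff)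
    have R: "?R = cell n i0 \<times> {\<omega> \<in> space M. Phi \<omega> \<in> cylinder n ?\<kappa>}"
    proof (intro equalityI subsetI)
      fix p assume p: "p \<in> ?R"
      obtain u \<omega> where [simp]: "p = (u, \<omega>)" by (cases p)
      have \<omega>: "\<omega> \<in> space M" using p by (auto simp: space_pair_measure)
      note lf = locally_finite_Phi[OF \<omega>]
      have emp: "Phi \<omega> \<inter> J = {}" using empty[OF lf] p by simp
      let ?i = "\<lfloor>u * 2 ^ n\<rfloor>"
      have u: "u \<in> cell n ?i" by (simp add: cell_iff)
      have iI: "?i \<in> ?I" using Jcell p by simp
      have "card (insert u (Phi \<omega>) \<inter> cell n ?i) \<noteq> 0" using u finite_cell[OF lf, of n ?i]
          by (simp add: Int_insert_left)
      then have "\<kappa> ?i \<noteq> 0" using p iI I by (auto simp: cylinder_def)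
      then have ii: "?i = i0" using i0(3)[OF iI] by metis
      have "card (Phi \<omega> \<inter> cell n j) = ?\<kappa> j" if j: "j \<in> grid n" for j
      proof (cases "j = i0")
        case True
        have "Phi \<omega> \<inter> cell n i0 = {}" using emp cellJ[OF _ i0(1)] by blast
        then show ?thesis using True by simp
      next
        case False
        then have "card (Phi \<omega> \<inter> cell n j) = card (insert u (Phi \<omega>) \<inter> cell n j)" using same u ii by simp
        then show ?thesis using p j False by (simp add: cylinder_def)
      qed
      then show "p \<in> cell n i0 \<times> {\<omega> \<in> space M. Phi \<omega> \<in> cylinder n ?\<kappa>}"
        using u ii \<omega> lf by (simp add: cylinder_def)
    next
      fix p assume "p \<in> cell n i0 \<times> {\<omega> \<in> space M. Phi \<omega> \<in> cylinder n ?\<kappa>}"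
      then obtain u \<omega> where p: "p = (u, \<omega>)" "u \<in> cell n i0" "\<omega> \<in> space M" "Phi \<omega> \<in> cylinder n ?\<kappa>" by auto
      note lf = locally_finite_Phi[OF p(3)]
      have uJ: "u \<in> J" using cellJ[OF p(2) i0(1)] .
      have "(\<Sum>i\<in>?I. ?\<kappa> i) = 0" using i0(3) by (intro sum.neutral) auto
      then have c0: "card (Phi \<omega> \<inter> J) = 0" using J[OF p(4)] by simp
      have "card (insert u (Phi \<omega>) \<inter> cell n j) = \<kappa> j" if j: "j \<in> grid n" for j
      proof (cases "j = i0")
        case True
        have "Phi \<omega> \<inter> cell n i0 = {}" using empty[OF lf c0] cellJ[OF _ i0(1)] by blast
        then have "insert u (Phi \<omega>) \<inter> cell n i0 = {u}" using p(2) by auto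
        then show ?thesis using True i0(2) by simp
      next
        case False
        then show ?thesis using same[OF p(2) False] p(4) j by (simp add: cylinder_def)
      qed
      then have "insert u (Phi \<omega>) \<in> cylinder n \<kappa>" using locally_finite_insert[OF lf]
          by (simp add: cylinder_def)
      then show "p \<in> ?R" using p uJ c0 by (simp add: space_pair_measure)
    qed
    have L: "?L = {\<omega> \<in> space M. Phi \<omega> \<in> cylinder n \<kappa>}" using J[of _ \<kappa>] True by auto
    have ev: "{\<omega> \<in> space M. Phi \<omega> \<in> cylinder n \<kappa>'} \<in> events" for \<kappa>'
      using measurable_sets[OF Phi_measurable cylinder_sets[of n \<kappa>']]
          by (simp add: vimage_def Int_def conj_commute)
    have "(\<Prod>j\<in>grid n. pois n (\<kappa> j)) = pois n 1 * (\<Prod>j\<in>grid n - {i0}. pois n (\<kappa> j))"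
      using i0g i0(2) by (simp add: prod.remove)
    also have "(\<Prod>j\<in>grid n - {i0}. pois n (\<kappa> j)) = (\<Prod>j\<in>grid n - {i0}. pois n (?\<kappa> j))"
      by (intro prod.cong) auto
    also have "pois n 1 = lam * (1 / 2 ^ n) * pois n 0" by (simp add: pois_def)
    also have "lam * (1 / 2 ^ n) * pois n 0 * (\<Prod>j\<in>grid n - {i0}. pois n (?\<kappa> j)) = lam * (1 / 2 ^ n) * (\<Prod>j\<in>grid n. pois n (?\<kappa> j))"
      using i0g by (simp add: prod.remove[of _ i0])
    finally have "prob ?L = lam * (1 / 2 ^ n) * prob {\<omega> \<in> space M. Phi \<omega> \<in> cylinder n ?\<kappa>}"
      unfolding L cylinder_prob .
    moreover have "emeasure (lborel \<Otimes>\<^sub>M M) ?R = ennreal (1 / 2 ^ n) * emeasure M {\<omega> \<in> space M. Phi \<omega> \<in> cylinder n ?\<kappa>}"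
      unfolding R using ev by (subst emeasure_pair_measure_Times) (auto simp: emeasure_cell)
    ultimately show ?thesis using lam_pos
      by (simp add: emeasure_eq_measure ennreal_mult'[symmetric] mult.assoc)
  qed
qed

text \<open>A restricted form of the Mecke formula: given that there is exactly one point in the cell, that
  point is uniformly distributed in it and independent of the process outside the cell.\<close>

lemma add_point:
  assumes e: "1 \<le> e" and A: "A \<in> sets conf"
  defines "J \<equiv> cell e 0"
  shows "emeasure M {\<omega> \<in> space M. card (Phi \<omega> \<inter> J) = 1 \<and> Phi \<omega> \<in> A} =
    ennreal lam * emeasure (lborel \<Otimes>\<^sub>M M) {p \<in> space (lborel \<Otimes>\<^sub>M M). fst p \<in> J \<and> card (Phi (snd p) \<inter> J) = 0 \<and>
      insert (fst p) (Phi (snd p)) \<in> A}"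
proof -
  note [measurable] = add_point_measurable
  let ?P = "lborel \<Otimes>\<^sub>M M"
  define E1 where "E1 = {\<omega> \<in> space M. card (Phi \<omega> \<inter> J) = 1}"
  define E0 where "E0 = {p \<in> space ?P. fst p \<in> J \<and> card (Phi (snd p) \<inter> J) = 0}"
  define N1 where "N1 = distr (restrict_space M E1) conf Phi"
  define N0 where "N0 = scale_measure (ennreal lam) (distr (restrict_space ?P E0) conf (\<lambda>p. insert (fst p) (Phi (snd p))))"
  have E1: "E1 \<in> sets M" unfolding E1_def J_def by measurable
  have E0: "E0 \<in> sets ?P" unfolding E0_def J_def by measurable
  have N1: "emeasure N1 X = emeasure M {\<omega> \<in> space M. card (Phi \<omega> \<inter> J) = 1 \<and> Phi \<omega> \<in> X}"
      if X: "X \<in> sets conf" for X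
  proof -
    have "emeasure N1 X = emeasure (restrict_space M E1) (Phi -` X \<inter> space (restrict_space M E1))"
      unfolding N1_def using X by (intro emeasure_distr measurable_restrict_space1 Phi_measurable)
    also have "\<dots> = emeasure M (Phi -` X \<inter> space (restrict_space M E1))"
      using E1 by (intro emeasure_restrict_space) (auto simp: space_restrict_space)
    also have "Phi -` X \<inter> space (restrict_space M E1) = {\<omega> \<in> space M. card (Phi \<omega> \<inter> J) = 1 \<and> Phi \<omega> \<in> X}"
      by (auto simp: space_restrict_space E1_def)
    finally show ?thesis .
  qed
  have N0: "emeasure N0 X = ennreal lam * emeasure ?P {p \<in> space ?P. fst p \<in> J \<and>
      card (Phi (snd p) \<inter> J) = 0 \<and>
      insert (fst p) (Phi (snd p)) \<in> X}" if X: "X \<in> sets conf" for X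
  proof -
    let ?f = "\<lambda>p. insert (fst p) (Phi (snd p))"
    have "emeasure (distr (restrict_space ?P E0) conf ?f) X = emeasure (restrict_space ?P E0) (?f -` X \<inter> space (restrict_space ?P E0))"
      using X by (intro emeasure_distr measurable_restrict_space1 add_point_measurable)
    also have "\<dots> = emeasure ?P (?f -` X \<inter> space (restrict_space ?P E0))"
      using E0 by (intro emeasure_restrict_space) (auto simp: space_restrict_space)
    also have "?f -` X \<inter> space (restrict_space ?P E0) = {p \<in> space ?P. fst p \<in> J \<and>
        card (Phi (snd p) \<inter> J) = 0 \<and> ?f p \<in> X}"
      by (auto simp: space_restrict_space E0_def)
    finally show ?thesis unfolding N0_def by simp
  qed
  have total: "emeasure N1 (Collect locally_finite) = emeasure N0 (Collect locally_finite)"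
  proof -
    have "{p \<in> space ?P. fst p \<in> J \<and> card (Phi (snd p) \<inter> J) = 0 \<and>
        insert (fst p) (Phi (snd p)) \<in> Collect locally_finite} =
        J \<times> {\<omega> \<in> space M. card (Phi \<omega> \<inter> J) = 0}"
      using locally_finite_insert[OF locally_finite_Phi] by (auto simp: space_pair_measure)
    moreover have "{\<omega> \<in> space M. card (Phi \<omega> \<inter> J) = 0} \<in> events" unfolding J_def by measurable
    ultimately have "emeasure ?P {p \<in> space ?P. fst p \<in> J \<and> card (Phi (snd p) \<inter> J) = 0 \<and>
        insert (fst p) (Phi (snd p)) \<in> Collect locally_finite} =
        ennreal (1 / 2 ^ e) * emeasure M {\<omega> \<in> space M. card (Phi \<omega> \<inter> J) = 0}"
      by (simp add: emeasure_pair_measure_Times J_def emeasure_cell)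
    moreover have "{\<omega> \<in> space M. card (Phi \<omega> \<inter> J) = 1 \<and>
        Phi \<omega> \<in> Collect locally_finite} = {\<omega> \<in> space M. card (Phi \<omega> \<inter> J) = 1}"
      using locally_finite_Phi by auto
    moreover have "prob {\<omega> \<in> space M. card (Phi \<omega> \<inter> J) = 1} = lam * (1 / 2 ^ e) * prob {\<omega> \<in> space M. card (Phi \<omega> \<inter> J) = 0}"
      unfolding J_def by (simp only: count_prob cell_borel cell_bounded measure_cell) simp
    ultimately show ?thesis using sets.top[of conf] lam_pos
      by (simp add: N1 N0 emeasure_eq_measure ennreal_mult'[symmetric] mult.assoc)
  qed
  have "N1 = N0"
  proof (rule measure_eqI_generator_eq[where \<Omega> = "Collect locally_finite" and E = "cylinders e" and A = "\<lambda>_. Collect locally_finite"])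
    show "Int_stable (cylinders e)" by (rule Int_stable_cylinders)
    show "cylinders e \<subseteq> Pow (Collect locally_finite)" by (rule cylinders_Pow)
    show "sets N1 = sigma_sets (Collect locally_finite) (cylinders e)"
        "sets N0 = sigma_sets (Collect locally_finite) (cylinders e)"
      using sets_conf_cylinders[of e] by (simp_all add: N1_def N0_def)
    show "range (\<lambda>_. Collect locally_finite) \<subseteq> cylinders e" by (auto simp: cylinders_def)
    show "emeasure N1 (Collect locally_finite) \<noteq> \<infinity>"
      using N1[of "Collect locally_finite"] sets.top[of conf] by (simp add: emeasure_eq_measure)
  next
    fix X assume X: "X \<in> cylinders e"
    then consider "X = {}" | "X = Collect locally_finite" | n \<kappa> where "e \<le> n" "X = cylinder n \<kappa>"
        by (auto simp: cylinders_def)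
    then show "emeasure N1 X = emeasure N0 X"
    proof cases
      case 3
      show ?thesis unfolding N1[OF cylinders_sets[OF X]] N0[OF cylinders_sets[OF X]] unfolding 3(2) J_def
        by (rule add_point_cylinder[OF e 3(1)])
    qed (simp_all add: total)
  qed simp
  then show ?thesis using N1[OF A] N0[OF A] by simp
qed

lemma pair_sigma_finite_lborel: "pair_sigma_finite lborel M"
  by (intro pair_sigma_finite.intro lborel.sigma_finite_measure_axioms sigma_finite_measure_axioms)

lemma AE_no_tie_cell:
  assumes e: "1 \<le> e"
  shows "AE \<omega> in M. \<not> (card (Phi \<omega> \<inter> cell e 0) = 1 \<and> (\<exists>w\<in>Phi \<omega>. w \<in> cell e 0 \<and> tie (Phi \<omega>) w))"
proof -
  note [measurable] = add_point_measurable
  interpret LM: pair_sigma_finite lborel M by (rule pair_sigma_finite_lborel)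
  let ?J = "cell e 0"
  define A where "A = {S \<in> space conf. \<exists>w\<in>S. w \<in> ?J \<and> tie S w}"
  have "Measurable.pred conf (\<lambda>S. \<exists>w\<in>S. w \<in> ?J \<and> tie S w)"
  proof (rule pred_bex_point, rule pred_logic)
    fix h :: "real set \<Rightarrow> real" assume [measurable]: "h \<in> borel_measurable conf"
    show "Measurable.pred conf (\<lambda>S. h S \<in> ?J)" by measurable
    show "Measurable.pred conf (\<lambda>S. tie S (h S))" by (rule tie_measurable) fact
  qed
  then have A [measurable]: "A \<in> sets conf" unfolding A_def by measurable
  let ?R = "{p \<in> space (lborel \<Otimes>\<^sub>M M). fst p \<in> ?J \<and> card (Phi (snd p) \<inter> ?J) = 0 \<and>
      insert (fst p) (Phi (snd p)) \<in> A}"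
  let ?Q = "\<lambda>u \<omega>. \<not> (u \<in> ?J \<and> card (Phi \<omega> \<inter> ?J) = 0 \<and> insert u (Phi \<omega>) \<in> A)"
  have R_sets: "?R \<in> sets (lborel \<Otimes>\<^sub>M M)" by measurable
  have Q_sets: "{p \<in> space (lborel \<Otimes>\<^sub>M M). ?Q (fst p) (snd p)} \<in> sets (lborel \<Otimes>\<^sub>M M)" by measurable
  have "AE \<omega> in M. AE u in lborel. ?Q u \<omega>"
  proof (rule AE_I2)
    fix \<omega> assume \<omega>: "\<omega> \<in> space M"
    note lf = locally_finite_Phi[OF \<omega>]
    define C where "C = (\<lambda>(x, y, z). x + y - z) ` (Phi \<omega> \<times> Phi \<omega> \<times> Phi \<omega>)"
    have "countable C" unfolding C_def using locally_finite_countable[OF lf]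
        by (intro countable_image countable_SIGMA)
    then have "AE u in lborel. u \<notin> C" by (intro AE_not_in countable_imp_null_set_lborel)
    then show "AE u in lborel. ?Q u \<omega>"
    proof eventually_elim
      case (elim u)
      show ?case
      proof
        assume u: "u \<in> ?J \<and> card (Phi \<omega> \<inter> ?J) = 0 \<and> insert u (Phi \<omega>) \<in> A"
        then have "Phi \<omega> \<inter> ?J = {}" using finite_cell[OF lf] by simp
        then have "tie (insert u (Phi \<omega>)) u" using u unfolding A_def by blast
        then obtain x y z where xyz: "x \<in> Phi \<omega>" "y \<in> Phi \<omega>" "z \<in> Phi \<omega>" "u = x + y - z"
            unfolding tie_def by blast
        have "u \<in> C" unfolding C_def using xyz by (intro image_eqI[of _ _ "(x, y, z)"]) auto
        then show False using elim by blast
      qed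
    qed
  qed
  then have "AE u in lborel. AE \<omega> in M. ?Q u \<omega>" using LM.AE_commute[OF Q_sets] by simp
  then have "AE p in lborel \<Otimes>\<^sub>M M. ?Q (fst p) (snd p)" using LM.AE_pair_iff[OF Q_sets] by simp
  then have "emeasure (lborel \<Otimes>\<^sub>M M) ?R = 0"
    using AE_iff_measurable[OF R_sets, of "\<lambda>p. ?Q (fst p) (snd p)"] by auto
  then have z: "emeasure M {\<omega> \<in> space M. card (Phi \<omega> \<inter> ?J) = 1 \<and> Phi \<omega> \<in> A} = 0"
    using add_point[OF e A] by simp
  have ev: "{\<omega> \<in> space M. card (Phi \<omega> \<inter> ?J) = 1 \<and> Phi \<omega> \<in> A} \<in> events" by measurable
  have "AE \<omega> in M. \<not> (card (Phi \<omega> \<inter> ?J) = 1 \<and> Phi \<omega> \<in> A)"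
    using AE_iff_measurable[OF ev, of "\<lambda>\<omega>. \<not> (card (Phi \<omega> \<inter> ?J) = 1 \<and> Phi \<omega> \<in> A)"] z by auto
  with AE_space show ?thesis by eventually_elim (auto simp: A_def locally_finite_Phi)
qed

lemma AE_no_tie: "AE \<omega> in M. \<forall>w\<in>Phi \<omega>. \<not> tie (Phi \<omega>) w"
proof -
  define T where "T n j = (+) (- (real_of_int j / 2 ^ n))" for n :: nat and j
  have "AE \<omega> in M. \<not> (card (T n j ` Phi \<omega> \<inter> cell n 0) = 1 \<and> (\<exists>w\<in>T n j ` Phi \<omega>. w \<in> cell n 0 \<and>
      tie (T n j ` Phi \<omega>) w))"
    if "1 \<le> n" for n j
    unfolding T_def by (rule poisson_process.AE_no_tie_cell[OF translate that])
  then have "AE \<omega> in M. \<forall>n j. 1 \<le> n \<longrightarrow> \<not> (card (T n j ` Phi \<omega> \<inter> cell n 0) = 1 \<and>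
      (\<exists>w\<in>T n j ` Phi \<omega>. w \<in> cell n 0 \<and> tie (T n j ` Phi \<omega>) w))"
    unfolding AE_all_countable by (auto intro: AE_I2)
  with AE_space show ?thesis
  proof (eventually_elim, intro ballI notI)
    fix \<omega> w
    assume *: "\<omega> \<in> space M"
        "\<forall>n j. 1 \<le> n \<longrightarrow> \<not> (card (T n j ` Phi \<omega> \<inter> cell n 0) = 1 \<and> (\<exists>w\<in>T n j ` Phi \<omega>. w \<in> cell n 0 \<and>
        tie (T n j ` Phi \<omega>) w))"
      and w: "w \<in> Phi \<omega>" "tie (Phi \<omega>) w"
    obtain n where n: "1 \<le> n" "Phi \<omega> \<inter> cell n \<lfloor>w * 2 ^ n\<rfloor> = {w}"
      using ex_isolating_cell[OF locally_finite_Phi[OF *(1)] w(1)] by blast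
    let ?j = "\<lfloor>w * 2 ^ n\<rfloor>"
    have cell: "T n ?j x \<in> cell n 0 \<longleftrightarrow> x \<in> cell n ?j" for x
      unfolding cell_def T_def by (auto simp: add_divide_distrib)
    have "T n ?j ` Phi \<omega> \<inter> cell n 0 = T n ?j ` (Phi \<omega> \<inter> cell n ?j)" using cell by auto
    then have "T n ?j ` Phi \<omega> \<inter> cell n 0 = {T n ?j w}" using n(2) by simp
    moreover have "tie (T n ?j ` Phi \<omega>) (T n ?j w)" using w(2) unfolding T_def tie_translate .
    ultimately show False using *(2) n(1) by (metis Int_iff card_1_singleton_iff insertI1 One_nat_def)
  qed
qed

end

definition good :: "real set \<Rightarrow> bool" where
  "good S \<longleftrightarrow> (\<forall>w\<in>S. \<not> tie S w) \<and> (\<forall>k. \<forall>x\<in>S. \<not> last_end S k x) \<and> (\<forall>x\<in>S. \<not> persistent_gap S x)"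

lemma good_measurable: "Measurable.pred conf good"
  unfolding good_def
  by ((intro pred_point_intros pred_intros_countable tie_measurable last_end_measurable persistent_gap_measurable | assumption)+)

lemma good_translate: "good ((+) t ` S) = good S"
  unfolding good_def by (simp add: tie_translate last_end_translate persistent_gap_translate)

lemma eff_connected_if_good: "locally_finite S \<Longrightarrow> good S \<Longrightarrow> eff_connected S"
proof -
  assume S: "locally_finite S" "good S"
  then interpret generic_config S by unfold_locales (auto simp: good_def)
  show ?thesis using S(2) by (intro eff_connected_if_no_persistent_gap) (auto simp: good_def)
qed

context poisson_process
begin

lemma AE_good: "AE \<omega> in M. good (Phi \<omega>)"
proof -
  define \<phi> where "\<phi> S x \<longleftrightarrow> (\<forall>w\<in>S. \<not> tie S w) \<and> (\<forall>k. \<forall>x\<in>S. \<not> last_end S k x) \<and> persistent_gap S x" for S x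
  have "AE \<omega> in M. \<forall>x\<in>Phi \<omega>. \<not> \<phi> (Phi \<omega>) x"
  proof (rule AE_no_covariant_point)
    fix h :: "real set \<Rightarrow> real" assume "h \<in> borel_measurable conf"
    then show "Measurable.pred conf (\<lambda>S. \<phi> S (h S))" unfolding \<phi>_def
      by ((intro pred_point_intros pred_intros_countable tie_measurable last_end_measurable persistent_gap_measurable | assumption)+)
  next
    show "\<phi> ((+) t ` S) (t + x) = \<phi> S x" for t S x
      unfolding \<phi>_def by (simp add: tie_translate last_end_translate persistent_gap_translate)
  next
    fix S x y assume *: "locally_finite S" "x \<in> S" "y \<in> S" "\<phi> S x" "\<phi> S y"
    then interpret generic_config S by unfold_locales (auto simp: \<phi>_def)
    show "x = y" using * by (intro persistent_gap_unique) (auto simp: \<phi>_def)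
  qed
  with AE_no_tie AE_no_last_end show ?thesis
    by eventually_elim (auto simp: good_def \<phi>_def)
qed

lemma AE_good_insert_if_void:
  assumes e: "1 \<le> e"
  shows "AE \<omega> in M. Phi \<omega> \<inter> {- 1 / 2 ^ e <..< 1 / 2 ^ e} = {} \<longrightarrow> good (insert 0 (Phi \<omega>))"
proof -
  note [measurable] = add_point_measurable good_measurable
  interpret LM: pair_sigma_finite lborel M by (rule pair_sigma_finite_lborel)
  let ?J = "cell e 0"
  define A where "A = {S \<in> space conf. \<not> good S}"
  have A [measurable]: "A \<in> sets conf" unfolding A_def by measurable
  let ?R = "{p \<in> space (lborel \<Otimes>\<^sub>M M). fst p \<in> ?J \<and> card (Phi (snd p) \<inter> ?J) = 0 \<and>
      insert (fst p) (Phi (snd p)) \<in> A}"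
  have R_sets: "?R \<in> sets (lborel \<Otimes>\<^sub>M M)" by measurable
  have "emeasure M {\<omega> \<in> space M. card (Phi \<omega> \<inter> ?J) = 1 \<and> Phi \<omega> \<in> A} = 0"
  proof (rule emeasure_eq_0_AE)
    show "AE \<omega> in M. \<not> (card (Phi \<omega> \<inter> ?J) = 1 \<and> Phi \<omega> \<in> A)"
      using AE_good by eventually_elim (simp add: A_def)
  qed
  then have "emeasure (lborel \<Otimes>\<^sub>M M) ?R = 0" using add_point[OF e A] lam_pos by auto
  then have "AE p in lborel \<Otimes>\<^sub>M M. \<not> (fst p \<in> ?J \<and> card (Phi (snd p) \<inter> ?J) = 0 \<and>
      insert (fst p) (Phi (snd p)) \<in> A)"
    using AE_iff_measurable[OF R_sets, of "\<lambda>p. \<not> (fst p \<in> ?J \<and> card (Phi (snd p) \<inter> ?J) = 0 \<and>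
        insert (fst p) (Phi (snd p)) \<in> A)"] by auto
  then have AEu: "AE u in lborel. AE \<omega> in M. \<not> (u \<in> ?J \<and> card (Phi \<omega> \<inter> ?J) = 0 \<and> insert u (Phi \<omega>) \<in> A)"
    using LM.AE_pair by fastforce
  have "\<exists>u\<in>?J. AE \<omega> in M. \<not> (card (Phi \<omega> \<inter> ?J) = 0 \<and> insert u (Phi \<omega>) \<in> A)"
  proof (rule ccontr)
    assume neg: "\<not> ?thesis"
    have "AE u in lborel. u \<notin> ?J"
      using AEu by eventually_elim (use neg in auto)
    then have "emeasure lborel ?J = 0"
      using AE_iff_measurable[of ?J lborel "\<lambda>u. u \<notin> ?J"] by simp
    then show False by (simp add: emeasure_cell)
  qed
  then obtain u where u: "u \<in> ?J" "AE \<omega> in M. \<not> (card (Phi \<omega> \<inter> ?J) = 0 \<and> insert u (Phi \<omega>) \<in> A)" by blast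
  have ins: "insert u \<in> measurable conf conf"
    using measurable_compose[OF _ insert_measurable, of "\<lambda>S. (u, S)" conf] by simp
  have "Measurable.pred conf (\<lambda>S. \<not> (card (S \<inter> ?J) = 0 \<and> insert u S \<in> A))"
    using ins by measurable
  from AE_translate[OF this u(2), of u] AE_space show ?thesis
  proof (eventually_elim, intro impI)
    fix \<omega> assume *: "\<not> (card ((+) u ` Phi \<omega> \<inter> ?J) = 0 \<and> insert u ((+) u ` Phi \<omega>) \<in> A)" "\<omega> \<in> space M"
      "Phi \<omega> \<inter> {- 1 / 2 ^ e <..< 1 / 2 ^ e} = {}"
    have "x \<in> {- 1 / 2 ^ e <..< 1 / 2 ^ e}" if "u + x \<in> ?J" for x
      using that u(1) unfolding cell_def by auto
    then have "(+) u ` Phi \<omega> \<inter> ?J = {}" using *(3) by blast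
    then have "insert u ((+) u ` Phi \<omega>) \<notin> A" using *(1) by simp
    moreover have "insert u ((+) u ` Phi \<omega>) = (+) u ` insert 0 (Phi \<omega>)" by simp
    ultimately have "(+) u ` insert 0 (Phi \<omega>) \<notin> A" by metis
    moreover have "locally_finite ((+) u ` insert 0 (Phi \<omega>))"
      by (intro locally_finite_translate locally_finite_insert locally_finite_Phi *(2))
    ultimately have "good ((+) u ` insert 0 (Phi \<omega>))" unfolding A_def space_conf mem_Collect_eq by blast
    then show "good (insert 0 (Phi \<omega>))" by (simp only: good_translate)
  qed
qed

lemma AE_zero_notin: "AE \<omega> in M. 0 \<notin> Phi \<omega>"
proof -
  have [measurable]: "(\<lambda>\<omega>. card (Phi \<omega> \<inter> {0})) \<in> measurable M (count_space UNIV)"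
      by (rule count_measurable) auto
  have "prob {\<omega> \<in> space M. card (Phi \<omega> \<inter> {0}) = 0} = 1" using count_prob[of "{0}" 0] by simp
  then have "AE \<omega> in M. card (Phi \<omega> \<inter> {0}) = 0" by (subst (asm) prob_Collect_eq_1) measurable
  then show ?thesis by eventually_elim (auto simp: card_eq_0_iff)
qed

lemma AE_good_insert: "AE \<omega> in M. good (insert 0 (Phi \<omega>))"
proof -
  have "AE \<omega> in M. \<forall>e. 1 \<le> e \<longrightarrow> Phi \<omega> \<inter> {- 1 / 2 ^ e <..< 1 / 2 ^ e} = {} \<longrightarrow> good (insert 0 (Phi \<omega>))"
    unfolding AE_all_countable using AE_good_insert_if_void by (auto intro: AE_I2)
  with AE_zero_notin AE_space show ?thesis
  proof eventually_elim
    case (elim \<omega>)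
    have "finite (Phi \<omega> \<inter> {-1..1})" using locally_finite_Phi[OF elim(2)]
        by (simp add: locally_finite_def)
    from finite_set_avoid[OF this, of 0] obtain d where
      d: "d > 0" "\<And>y. y \<in> Phi \<omega> \<inter> {-1..1} \<Longrightarrow> y \<noteq> 0 \<Longrightarrow> d \<le> dist 0 y" by metis
    obtain e where e: "1 \<le> e" "1 / 2 ^ e < d" using ex_small_cell[OF d(1)] by blast
    have "1 / 2 ^ e \<le> (1 :: real)" by simp
    then have "y \<in> {-1..1} \<and> \<bar>y\<bar> < d" if "y \<in> {- 1 / 2 ^ e <..< 1 / 2 ^ e}" for y
      using that e(2) unfolding greaterThanLessThan_iff atLeastAtMost_iff minus_divide_left[symmetric] by linarith
    then have "Phi \<omega> \<inter> {- 1 / 2 ^ e <..< 1 / 2 ^ e} = {}"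
      using d(2) elim(1) by (fastforce simp: dist_real_def)
    then show ?case using elim(3) e(1) by blast
  qed
qed

end

theorem mainTheorem6:
  fixes M :: "'w measure" and lam :: real and Phi :: "'w \<Rightarrow> real set"
  assumes "prob_space M"
    and "poisson_pp M lam Phi"
  shows "AE \<omega> in M. eff_connected (insert 0 (Phi \<omega>))"
proof -
  interpret prob_space M by fact
  interpret poisson_process M lam Phi by unfold_locales fact
  show ?thesis using AE_good_insert AE_space
    by eventually_elim (auto intro!: eff_connected_if_good locally_finite_insert locally_finite_Phi)
qed

end
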